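(* For every fixed natural number $k$ there is a polynomial-time algorithm that, given a graph $G$ together with a partition of its vertex set into $k$ sets $A_1,\ldots,A_k$ each of which is a clique of $G$, decides whether the vertex set of $G$ can be partitioned into triangles.
   Context: Such a graph $G$ is exactly the complement of a $k$-partite graph with the given color classes; the color classes are part of the input. *)

theory Defs
  imports Main "HOL-Library.Disjoint_Sets"
begin

text \<open>A (finite simple) graph on vertex set {0..<n}: an edge relation E restricted to
  {0..<n}, symmetric and irreflexive there.  The partition A_1,...,A_k is given by a
  colour function col: vertex v lies in A_(col v + 1), col v < k.  Parts may be empty.\<close>

definition simple_graph :: "nat \<Rightarrow> (nat \<Rightarrow> nat \<Rightarrow> bool) \<Rightarrow> bool" where
  "simple_graph n E \<longleftrightarrow> (\<forall>u<n. \<not> E u u) \<and> (\<forall>u<n. \<forall>v<n. E u v \<longrightarrow> E v u)"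

definition clique_partition_instance ::
  "nat \<Rightarrow> nat \<Rightarrow> (nat \<Rightarrow> nat \<Rightarrow> bool) \<Rightarrow> (nat \<Rightarrow> nat) \<Rightarrow> bool" where
  "clique_partition_instance k n E col \<longleftrightarrow>
     simple_graph n E \<and> (\<forall>v<n. col v < k) \<and>
     (\<forall>u<n. \<forall>v<n. u \<noteq> v \<and> col u = col v \<longrightarrow> E u v)"

definition triangle_partitionable :: "nat \<Rightarrow> (nat \<Rightarrow> nat \<Rightarrow> bool) \<Rightarrow> bool" where
  "triangle_partitionable n E \<longleftrightarrow>
     (\<exists>P. partition_on {0..<n} P \<and>
          (\<forall>t\<in>P. card t = 3 \<and> (\<forall>u\<in>t. \<forall>v\<in>t. u \<noteq> v \<longrightarrow> E u v)))"

text \<open>Input alphabet {1,2,3}: 1 = bit 0, 2 = bit 1 / unary digit, 3 = separator; 0 = blank.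
  Encoding: the n*n adjacency matrix (row by row), separator, then for each vertex v
  its colour col v in unary followed by a separator.\<close>

definition bit_sym :: "bool \<Rightarrow> nat" where
  "bit_sym b = (if b then 2 else 1)"

definition encode :: "nat \<Rightarrow> (nat \<Rightarrow> nat \<Rightarrow> bool) \<Rightarrow> (nat \<Rightarrow> nat) \<Rightarrow> nat list" where
  "encode n E col =
     concat (map (\<lambda>u. map (\<lambda>v. bit_sym (E u v)) [0..<n]) [0..<n]) @ [3] @
     concat (map (\<lambda>v. replicate (col v) 2 @ [3]) [0..<n])"

datatype move = MoveL | MoveR | Stay

record tm =
  nstates :: nat
  nsyms :: nat
  delta :: "nat \<Rightarrow> nat \<Rightarrow> nat \<times> nat \<times> move"
  acc_state :: nat
  rej_state :: nat

text \<open>Finitely many states and tape symbols; start state 0; symbol 0 is the blank;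
  input symbols are 1,2,3.\<close>

definition wf_tm :: "tm \<Rightarrow> bool" where
  "wf_tm M \<longleftrightarrow> 4 \<le> nsyms M \<and> 0 < nstates M \<and> acc_state M < nstates M \<and>
     rej_state M < nstates M \<and> acc_state M \<noteq> rej_state M \<and>
     (\<forall>q<nstates M. \<forall>s<nsyms M. case delta M q s of (q', s', _) \<Rightarrow>
        q' < nstates M \<and> s' < nsyms M)"

text \<open>Configuration: (state, cells left of the head in reverse order, cells from the head
  rightwards).  The tape is two-way infinite with blanks.\<close>

type_synonym config = "nat \<times> nat list \<times> nat list"

definition halted :: "tm \<Rightarrow> config \<Rightarrow> bool" where
  "halted M c \<longleftrightarrow> fst c = acc_state M \<or> fst c = rej_state M"

definition accepted :: "tm \<Rightarrow> config \<Rightarrow> bool" where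
  "accepted M c \<longleftrightarrow> fst c = acc_state M"

fun step :: "tm \<Rightarrow> config \<Rightarrow> config" where
  "step M (q, ls, rs) =
     (if q = acc_state M \<or> q = rej_state M then (q, ls, rs) else
      (let s = (case rs of [] \<Rightarrow> 0 | x # _ \<Rightarrow> x);
           (q', s', m) = delta M q s;
           rs' = s' # tl rs
       in case m of
            MoveL \<Rightarrow> (case ls of [] \<Rightarrow> (q', [], 0 # rs') | x # ls' \<Rightarrow> (q', ls', x # rs'))
          | MoveR \<Rightarrow> (q', s' # ls, tl rs')
          | Stay \<Rightarrow> (q', ls, rs')))"

definition run :: "tm \<Rightarrow> nat \<Rightarrow> nat list \<Rightarrow> config" where
  "run M t xs = (step M ^^ t) (0, [], xs)"

end

theory Submission
  imports Defs "HOL-Library.Nat_Bijection" "HOL-Library.FuncSet"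
begin

text \<open>In a triangle partition with the fewest non-monochromatic triangles, no three of these
  have the same (ordered) colour triple: otherwise regrouping their nine vertices by colour
  gives three monochromatic triangles. Hence at most \<open>2 * k ^ 3\<close> triangles are not
  monochromatic, and a partition exists iff one can choose at most that many disjoint triangles
  such that the number of remaining vertices of every colour is a multiple of 3.

  For fixed \<open>k\<close> this is a search over a constant number of vertices, which a machine
  with a constant number of registers bounded by the input length \<open>N\<close> performs. A register
  with value \<open>i\<close> is kept as a mark on tape cell \<open>i\<close>, so that a single-tape
  Turing machine simulates one register step by a sweep of \<open>O(N)\<close> steps. The register
  programs have only for-loops, hence run in polynomial time.\<close>

section \<open>Triangle partitions with few non-monochromatic triangles\<close>

text \<open>A colour class is a clique, so each of its subsets whose size is a multiple of 3 splits
  into triangles arbitrarily. What the multicoloured triangles leave behind therefore matters only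
  through one residue modulo 3 per class. Colour triples are ordered because regrouping matches
  vertices position by position; colours inside a triple may repeat. Two triangles for each of
  \<open>k ^ 3\<close> triples make \<open>6 * k ^ 3\<close> vertex entries, which is both the
  number of entry registers and the nesting depth of the search loops. Hence the degree of the
  polynomial grows with \<open>k\<close> but is constant for fixed \<open>k\<close>.

  The time bound concerns a concrete single-tape machine. Binary arithmetic is avoided there because
  every stored quantity is at most the input length: the matrix has a cell for each address
  \<open>u * n + v\<close>, and colours are written in unary. Values can thus be tape positions, and
  two registers are equal iff their marks share a cell.\<close>

abbreviation is_triangle :: "(nat \<Rightarrow> nat \<Rightarrow> bool) \<Rightarrow> nat set \<Rightarrow> bool" where
  "is_triangle E t \<equiv> card t = 3 \<and> (\<forall>u\<in>t. \<forall>v\<in>t. u \<noteq> v \<longrightarrow> E u v)"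

definition triangle_partition :: "(nat \<Rightarrow> nat \<Rightarrow> bool) \<Rightarrow> nat set \<Rightarrow> nat set set \<Rightarrow> bool" where
  "triangle_partition E X P \<longleftrightarrow> partition_on X P \<and> (\<forall>t\<in>P. is_triangle E t)"

lemma triangle_partitionD:
  assumes "triangle_partition E X P"
  shows "t \<in> P \<Longrightarrow> is_triangle E t" "t \<in> P \<Longrightarrow> t \<subseteq> X" "\<Union>P = X"
    and "s \<in> P \<Longrightarrow> t \<in> P \<Longrightarrow> u \<in> s \<Longrightarrow> u \<in> t \<Longrightarrow> s = t"
  using assms by (auto simp: triangle_partition_def partition_on_def disjoint_def)

lemma triangle_partition_Diff:
  assumes tp: "triangle_partition E X P" and F: "F \<subseteq> P"
  shows "triangle_partition E (X - \<Union>F) (P - F)"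
proof -
  have "\<Union>(P - F) = X - \<Union>F"
  proof (intro equalityI subsetI)
    fix u assume "u \<in> \<Union>(P - F)"
    then obtain t where t: "t \<in> P" "t \<notin> F" "u \<in> t" by auto
    have "u \<notin> s" if "s \<in> F" for s
      using triangle_partitionD(4)[OF tp _ t(1) _ t(3), of s] that t(2) F by auto
    then show "u \<in> X - \<Union>F" using triangle_partitionD(2)[OF tp t(1)] t(3) by auto
  qed (use triangle_partitionD(3)[OF tp] in auto)
  moreover have "disjoint (P - F)" "{} \<notin> P - F"
    using tp unfolding triangle_partition_def partition_on_def disjoint_def by auto
  ultimately show ?thesis using tp unfolding triangle_partition_def partition_on_def by auto
qed

lemma triangle_partition_Un:
  assumes "triangle_partition E X P" "triangle_partition E Y R" "X \<inter> Y = {}"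
  shows "triangle_partition E (X \<union> Y) (P \<union> R)"
proof -
  have P: "partition_on X P" and R: "partition_on Y R"
    using assms by (simp_all add: triangle_partition_def)
  have "disjoint (P \<union> R)"
    by (rule disjoint_union[OF partition_onD2[OF P] partition_onD2[OF R]])
      (use partition_onD1[OF P] partition_onD1[OF R] assms(3) in simp)
  then have "partition_on (X \<union> Y) (P \<union> R)"
    using partition_onD1[OF P] partition_onD1[OF R] partition_onD3[OF P] partition_onD3[OF R]
    by (auto simp: partition_on_def)
  with assms(1,2) show ?thesis by (auto simp: triangle_partition_def)
qed

lemma triangle_partition_UN:
  assumes "finite I" "\<And>i. i \<in> I \<Longrightarrow> \<exists>P. triangle_partition E (X i) P"
    "\<And>i j. i \<in> I \<Longrightarrow> j \<in> I \<Longrightarrow> i \<noteq> j \<Longrightarrow> X i \<inter> X j = {}"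
  shows "\<exists>P. triangle_partition E (\<Union>i\<in>I. X i) P"
  using assms
proof (induction I)
  case empty
  have "triangle_partition E {} {}" by (simp add: triangle_partition_def partition_on_def)
  then show ?case by auto
next
  case (insert i I)
  obtain P where P: "triangle_partition E (\<Union>j\<in>I. X j) P" using insert by (metis insertCI)
  obtain R where R: "triangle_partition E (X i) R" using insert by blast
  have "X i \<inter> (\<Union>j\<in>I. X j) = {}" using insert.prems(2) insert.hyps by fastforce
  then have "triangle_partition E (X i \<union> (\<Union>j\<in>I. X j)) (R \<union> P)"
    by (rule triangle_partition_Un[OF R P])
  then show ?case by auto
qed

lemma triangle_partition_singleton:
  "is_triangle E t \<Longrightarrow> triangle_partition E t {t}"
  by (auto simp: triangle_partition_def partition_on_def)

text \<open>Split off any three vertices; the rest is again a clique of size divisible by 3.\<close>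

lemma clique_triangle_partition:
  assumes "finite X" "\<And>u v. u \<in> X \<Longrightarrow> v \<in> X \<Longrightarrow> u \<noteq> v \<Longrightarrow> E u v" "3 dvd card X"
  shows "\<exists>P. triangle_partition E X P"
  using assms
proof (induction "card X" arbitrary: X rule: less_induct)
  case less
  show ?case
  proof (cases "X = {}")
    case True
    then have "triangle_partition E X {}" by (simp add: triangle_partition_def partition_on_def)
    then show ?thesis by blast
  next
    case False
    then have "3 \<le> card X" using less.prems by (auto dest: dvd_imp_le simp: card_gt_0_iff)
    then obtain t where t: "t \<subseteq> X" "card t = 3" using obtain_subset_with_card_n by metis
    have ft: "finite t" using t less.prems(1) finite_subset by blast
    have c: "card (X - t) = card X - 3" using t ft by (simp add: card_Diff_subset)
    have "\<exists>P. triangle_partition E (X - t) P"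
    proof (rule less.hyps)
      show "card (X - t) < card X" using c \<open>3 \<le> card X\<close> by simp
      show "3 dvd card (X - t)" using c less.prems(3) \<open>3 \<le> card X\<close> by (simp add: dvd_diff_nat)
    qed (use less.prems in auto)
    then obtain P where "triangle_partition E (X - t) P" ..
    moreover have "triangle_partition E t {t}"
      by (rule triangle_partition_singleton) (use t less.prems(2) in auto)
    ultimately have "triangle_partition E ((X - t) \<union> t) (P \<union> {t})"
      by (rule triangle_partition_Un) auto
    then show ?thesis using t by (auto simp: Un_absorb2)
  qed
qed

section \<open>Exchanging triangles of equal colour type\<close>

definition monochromatic :: "(nat \<Rightarrow> nat) \<Rightarrow> nat set \<Rightarrow> bool" where
  "monochromatic col t \<longleftrightarrow> (\<forall>u\<in>t. \<forall>v\<in>t. col u = col v)"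

text \<open>The colours \<open>a\<close>, \<open>b\<close>, \<open>c\<close> may coincide, so
  colours cannot separate the three new triangles: their disjointness comes from that of the old
  triangles together with the distinctness of \<open>x t\<close>, \<open>y t\<close>,
  \<open>z t\<close>. They cover exactly \<open>\<Union>F\<close>, so the rest of the partition can
  stay.\<close>

lemma recolour_three:
  assumes tp: "triangle_partition E X P"
    and clique: "\<And>u v. u \<in> X \<Longrightarrow> v \<in> X \<Longrightarrow> u \<noteq> v \<Longrightarrow> col u = col v \<Longrightarrow> E u v"
    and f: "\<And>t. t \<in> F \<Longrightarrow> t = {x t, y t, z t} \<and> x t \<noteq> y t \<and> x t \<noteq> z t \<and> y t \<noteq> z t \<and>
        col (x t) = a \<and> col (y t) = b \<and> col (z t) = c"
    and F: "F \<subseteq> P" "card F = 3"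
  shows "triangle_partition E X (P - F \<union> {x ` F, y ` F, z ` F})" and "monochromatic col (x ` F)" "monochromatic col (y ` F)" "monochromatic col (z ` F)"
proof -
  have dj: "s = t" if "s \<in> F" "t \<in> F" "u \<in> s" "u \<in> t" for s t u
    using triangle_partitionD(4)[OF tp] F that by (metis subsetD)
  have mem: "x t \<in> t" "y t \<in> t" "z t \<in> t" if "t \<in> F" for t
    using f[OF that] by (metis insertCI)+
  have ne: "x t \<noteq> y t" "x t \<noteq> z t" "y t \<noteq> z t"
    and cols: "col (x t) = a" "col (y t) = b" "col (z t) = c" if "t \<in> F" for t
    using f[OF that] by blast+
  have FX: "t \<subseteq> X" if "t \<in> F" for t
    using that F triangle_partitionD(2)[OF tp] by (metis subsetD)
  show m: "monochromatic col (x ` F)" "monochromatic col (y ` F)" "monochromatic col (z ` F)" by (auto simp: monochromatic_def cols)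
  have "inj_on g F" if g: "\<And>t. t \<in> F \<Longrightarrow> g t \<in> t" for g
  proof (rule inj_onI)
    fix s t assume "s \<in> F" "t \<in> F" "g s = g t"
    then show "s = t" using dj[of s t "g s"] g[of s] g[of t] by simp
  qed
  note inj = this[OF mem(1)] this[OF mem(2)] this[OF mem(3)]
  have "g ` F \<subseteq> X" if g: "\<And>t. t \<in> F \<Longrightarrow> g t \<in> t" for g
  proof (rule image_subsetI)
    fix t assume "t \<in> F"
    then show "g t \<in> X" using FX[of t] g[of t] by auto
  qed
  note sub = this[OF mem(1)] this[OF mem(2)] this[OF mem(3)]
  have tr: "is_triangle E A" if "A \<subseteq> X" "monochromatic col A" "card A = 3" for A
  proof (intro conjI ballI impI that(3))
    fix u v assume uv: "u \<in> A" "v \<in> A" "u \<noteq> v"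
    show "E u v"
    proof (rule clique)
      show "col u = col v" using that(2) uv unfolding monochromatic_def by blast
    qed (use that(1) uv in auto)
  qed
  have xy: "x ` F \<inter> y ` F = {}"
  proof (rule ccontr)
    assume "x ` F \<inter> y ` F \<noteq> {}"
    then obtain s t where "s \<in> F" "t \<in> F" "x s = y t" by auto
    with dj[of s t "x s"] mem[of s] mem[of t] have "s = t" by simp
    with \<open>x s = y t\<close> \<open>s \<in> F\<close> ne(1)[of s] show False by simp
  qed
  have xyz: "(x ` F \<union> y ` F) \<inter> z ` F = {}"
  proof (rule ccontr)
    assume "(x ` F \<union> y ` F) \<inter> z ` F \<noteq> {}"
    then obtain u where "u \<in> x ` F \<union> y ` F" "u \<in> z ` F" by blast
    then obtain s t where st: "s \<in> F" "t \<in> F" "z t = x s \<or> z t = y s" by auto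
    have "z t \<in> s" using st(3) mem(1,2)[OF st(1)] by (elim disjE) simp_all
    then have "s = t" using dj[OF st(1,2) _ mem(3)[OF st(2)]] by simp
    then show False using st(3) ne(2,3)[OF st(1)] by simp
  qed
  have "triangle_partition E (x ` F \<union> y ` F \<union> z ` F) ({x ` F} \<union> {y ` F} \<union> {z ` F})"
  proof (rule triangle_partition_Un[OF triangle_partition_Un _ xyz])
    have c: "card (x ` F) = 3" "card (y ` F) = 3" "card (z ` F) = 3"
      by (simp_all add: card_image inj F)
    show "triangle_partition E (x ` F) {x ` F}"
      by (rule triangle_partition_singleton[OF tr[OF sub(1) m(1) c(1)]])
    show "triangle_partition E (y ` F) {y ` F}"
      by (rule triangle_partition_singleton[OF tr[OF sub(2) m(2) c(2)]])
    show "triangle_partition E (z ` F) {z ` F}"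
      by (rule triangle_partition_singleton[OF tr[OF sub(3) m(3) c(3)]])
  qed (rule xy)
  moreover have "x ` F \<union> y ` F \<union> z ` F = \<Union>F"
  proof (intro equalityI subsetI)
    fix u assume "u \<in> \<Union>F"
    then obtain t where t: "t \<in> F" "u \<in> t" by auto
    have "t = {x t, y t, z t}" using f[OF t(1)] by blast
    from subst[OF this, of "\<lambda>s. u \<in> s", OF t(2)] have "u \<in> {x t, y t, z t}" .
    then show "u \<in> x ` F \<union> y ` F \<union> z ` F" using t(1) by auto
  next
    fix u assume "u \<in> x ` F \<union> y ` F \<union> z ` F"
    then show "u \<in> \<Union>F" using mem by blast
  qed
  ultimately have 1: "triangle_partition E (\<Union>F) {x ` F, y ` F, z ` F}" by (simp add: insert_commute)
  have 2: "triangle_partition E (X - \<Union>F) (P - F)"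
    using triangle_partition_Diff[OF tp F(1)] .
  have "triangle_partition E ((X - \<Union>F) \<union> \<Union>F) ((P - F) \<union> {x ` F, y ` F, z ` F})"
    by (rule triangle_partition_Un[OF 2 1]) auto
  moreover have "(X - \<Union>F) \<union> \<Union>F = X" using FX by auto
  ultimately show "triangle_partition E X (P - F \<union> {x ` F, y ` F, z ` F})" by simp
qed

lemma few_nonmonochromatic_triangles:
  assumes inst: "clique_partition_instance k n E col" and "triangle_partitionable n E"
  obtains P where "triangle_partition E {0..<n} P" "card {t \<in> P. \<not> monochromatic col t} \<le> 2 * k ^ 3"
proof -
  define bad where "bad P = {t \<in> P. \<not> monochromatic col t}" for P
  obtain P0 where P0: "triangle_partition E {0..<n} P0"
    using assms(2) unfolding triangle_partitionable_def triangle_partition_def by auto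
  obtain P where tp: "triangle_partition E {0..<n} P"
    and least: "\<And>R. triangle_partition E {0..<n} R \<Longrightarrow> card (bad P) \<le> card (bad R)"
    using ex_has_least_nat[of "triangle_partition E {0..<n}" P0 "\<lambda>P. card (bad P)", OF P0] by auto
  have finP: "finite P" using tp by (auto simp: triangle_partition_def intro: finite_elements)
  note PX = triangle_partitionD(2)[OF tp]
  have "\<exists>x y z. t = {x, y, z} \<and> x \<noteq> y \<and> x \<noteq> z \<and> y \<noteq> z" if "t \<in> P" for t
    using triangle_partitionD(1)[OF tp that] by (auto simp: card_3_iff)
  then obtain x y z where xyz: "\<And>t. t \<in> P \<Longrightarrow> t = {x t, y t, z t} \<and> x t \<noteq> y t \<and> x t \<noteq> z t \<and> y t \<noteq> z t"
    by metis
  \<comment> \<open>The enumeration of each triangle is arbitrary but fixed; recording colours in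
    this order makes triangles of equal type match position by position.\<close>
  define ty where "ty t = (col (x t), col (y t), col (z t))" for t
  let ?B = "{..<k} \<times> {..<k} \<times> {..<k}"
  have ck: "col v < k" if "v < n" for v using inst that by (simp add: clique_partition_instance_def)
  have ty: "ty \<in> bad P \<rightarrow> ?B"
  proof
    fix t assume "t \<in> bad P"
    then have "t \<in> P" by (simp add: bad_def)
    then have "{x t, y t, z t} \<subseteq> {0..<n}" using PX xyz by metis
    then show "ty t \<in> ?B" by (simp add: ty_def ck)
  qed
  have "card (bad P) \<le> 2 * k ^ 3"
  proof (rule ccontr)
    assume big: "\<not> card (bad P) \<le> 2 * k ^ 3"
    then have ne: "bad P \<noteq> {}" by auto
    then have "?B \<noteq> {}" using ty by blast
    then obtain ab where ab: "card (ty -` {ab} \<inter> bad P) * card ?B \<ge> card (bad P)"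
      using pigeonhole_card[OF ty] finP by (auto simp: bad_def)
    \<comment> \<open>A fibre of at most two triangles, times \<open>k ^ 3\<close> types, would fall
      short of the pigeonhole bound.\<close>
    have "card (ty -` {ab} \<inter> bad P) \<ge> 3"
    proof (rule ccontr)
      assume "\<not> 3 \<le> card (ty -` {ab} \<inter> bad P)"
      then have "card (ty -` {ab} \<inter> bad P) * card ?B \<le> 2 * card ?B" by (intro mult_right_mono) auto
      also have "\<dots> = 2 * k ^ 3" by (simp add: card_cartesian_product power3_eq_cube)
      finally show False using ab big by linarith
    qed
    then obtain F where F: "F \<subseteq> ty -` {ab} \<inter> bad P" "card F = 3"
      using obtain_subset_with_card_n by metis
    obtain a b c where abc: "ab = (a, b, c)" by (cases ab)
    have cl: "E u v" if "u \<in> {0..<n}" "v \<in> {0..<n}" "u \<noteq> v" "col u = col v" for u v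
      using inst that by (auto simp: clique_partition_instance_def)
    have FP: "F \<subseteq> P" using F by (auto simp: bad_def)
    have Fp: "t = {x t, y t, z t} \<and> x t \<noteq> y t \<and> x t \<noteq> z t \<and> y t \<noteq> z t \<and>
        col (x t) = a \<and> col (y t) = b \<and> col (z t) = c" if "t \<in> F" for t
    proof -
      have "t \<in> P" "ty t = (a, b, c)" using that F FP abc by auto
      then show ?thesis using xyz[of t] unfolding ty_def by blast
    qed
    let ?R = "P - F \<union> {x ` F, y ` F, z ` F}"
    note rec = recolour_three[where x = x and y = y and z = z, OF tp cl Fp FP F(2)]
    have "card (bad P) \<le> card (bad ?R)" by (rule least[OF rec(1)])
    \<comment> \<open>The replacements add nothing to \<open>bad\<close>, so the exchange lowers the
      count by three, against minimality.\<close>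
    moreover have "bad ?R = bad P - F"
    proof -
      have "monochromatic col t" if "t \<in> {x ` F, y ` F, z ` F}" for t using that rec(2-4) by blast
      then show ?thesis unfolding bad_def by blast
    qed
    moreover have "F \<subseteq> bad P" using F by auto
    then have "card (bad P - F) = card (bad P) - 3"
      using F(2) by (simp add: card_Diff_subset card_ge_0_finite)
    then have "card (bad P - F) < card (bad P)" using big by simp
    ultimately show False by simp
  qed
  with that[of P] tp show thesis unfolding bad_def by simp
qed

section \<open>Choices of boundedly many triangles\<close>

text \<open>\<open>same\<close> says that both entries belong to one block of three: such a block is
  entirely empty or consists of adjacent vertices, which differ because \<open>E\<close> is
  irreflexive. Across blocks it is enough to test \<open>u = n\<close>: if only \<open>v\<close> is
  \<open>n\<close>, then \<open>u\<close> differs from it anyway.\<close>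

definition pair_ok :: "nat \<Rightarrow> (nat \<Rightarrow> nat \<Rightarrow> bool) \<Rightarrow> bool \<Rightarrow> nat \<Rightarrow> nat \<Rightarrow> bool" where
  "pair_ok n E same u v \<longleftrightarrow>
     (if same then u = n \<and> v = n \<or> u < n \<and> v < n \<and> E u v else u = n \<or> u \<noteq> v)"

text \<open>\<open>f\<close> lists up to \<open>m div 3\<close> disjoint triangles, triangle \<open>i\<close> being
  \<open>f (3 * i), f (3 * i + 1), f (3 * i + 2)\<close>; the value \<open>n\<close> marks an unused entry.\<close>

definition good_choice ::
  "nat \<Rightarrow> (nat \<Rightarrow> nat \<Rightarrow> bool) \<Rightarrow> (nat \<Rightarrow> nat) \<Rightarrow> nat \<Rightarrow> (nat \<Rightarrow> nat) \<Rightarrow> bool" where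
  "good_choice n E col m f \<longleftrightarrow>
     (\<forall>p<m. \<forall>q<m. p \<noteq> q \<longrightarrow> pair_ok n E (p div 3 = q div 3) (f p) (f q)) \<and>
     (\<forall>a. 3 dvd card {v. v < n \<and> col v = a \<and> v \<notin> f ` {..<m}})"

text \<open>The filled blocks are disjoint triangles, the left-over of each class is a clique of
  size divisible by 3, and together they exhaust the vertices.\<close>

lemma triangle_partitionable_if_good_choice:
  assumes inst: "clique_partition_instance k n E col"
    and f: "\<And>p. p < 3 * r \<Longrightarrow> f p \<le> n" and g: "good_choice n E col (3 * r) f"
  shows "triangle_partitionable n E"
proof -
  \<comment> \<open>The first entry decides whether a block is filled, since \<open>pair_ok\<close>
    makes its entries all \<open>n\<close> or all vertices.\<close>
  define I where "I = {i. i < r \<and> f (3 * i) < n}"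
  define T where "T i = {f (3 * i), f (3 * i + 1), f (3 * i + 2)}" for i
  define C where "C a = {v. v < n \<and> col v = a \<and> v \<notin> f ` {..<3 * r}}" for a
  have irr: "\<not> E u u" if "u < n" for u
    using inst that by (simp add: clique_partition_instance_def simple_graph_def)
  have ok: "pair_ok n E (p div 3 = q div 3) (f p) (f q)" if "p < 3 * r" "q < 3 * r" "p \<noteq> q" for p q
    using g that by (simp add: good_choice_def)
  have T: "is_triangle E (T i)" "T i \<subseteq> {0..<n}" if "i \<in> I" for i
  proof -
    have d: "(3 * i + 1) div 3 = i" "(3 * i + 2) div 3 = i" by auto
    have i: "i < r" "f (3 * i) < n" using that by (auto simp: I_def)
    have E: "E (f p) (f q)" if "p \<in> {3 * i, 3 * i + 1, 3 * i + 2}" "q \<in> {3 * i, 3 * i + 1, 3 * i + 2}" "p \<noteq> q" for p q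
    proof -
      have l: "f s < n" if "s \<in> {3 * i, 3 * i + 1, 3 * i + 2}" for s
        using ok[of "3 * i" s] i that d by (cases "s = 3 * i") (auto simp: pair_ok_def)
      have "p div 3 = q div 3" using that d by auto
      then show ?thesis using ok[of p q] l[OF that(1)] l[OF that(2)] that i by (auto simp: pair_ok_def)
    qed
    have l: "f (3 * i + 1) < n" "f (3 * i + 2) < n"
      using ok[of "3 * i" "3 * i + 1"] ok[of "3 * i" "3 * i + 2"] i d by (auto simp: pair_ok_def)
    then show "T i \<subseteq> {0..<n}" using i by (auto simp: T_def)
    have e: "E (f (3 * i)) (f (3 * i + 1))" "E (f (3 * i)) (f (3 * i + 2))" "E (f (3 * i + 1)) (f (3 * i + 2))"
      "E (f (3 * i + 1)) (f (3 * i))" "E (f (3 * i + 2)) (f (3 * i))" "E (f (3 * i + 2)) (f (3 * i + 1))"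
      by (rule E; simp)+
    then have "f (3 * i) \<noteq> f (3 * i + 1)" "f (3 * i) \<noteq> f (3 * i + 2)" "f (3 * i + 1) \<noteq> f (3 * i + 2)"
      using irr i l by metis+
    with e show "is_triangle E (T i)" by (auto simp: T_def)
  qed
  have cover: "v \<in> (\<Union>i\<in>I. T i)" if "v < n" "p < 3 * r" "v = f p" for v p
  proof -
    let ?i = "p div 3"
    have i: "?i < r" using that by auto
    have p: "p = 3 * ?i \<or> p = 3 * ?i + 1 \<or> p = 3 * ?i + 2" by arith
    then have "f (3 * ?i) < n"
      using ok[of "3 * ?i" p] that i by (cases "p = 3 * ?i") (auto simp: pair_ok_def)
    moreover have "v \<in> T ?i" using p that by (auto simp: T_def)
    ultimately show ?thesis using i by (auto simp: I_def)
  qed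
  have "\<exists>P. triangle_partition E (\<Union>i\<in>I. T i) P"
  proof (rule triangle_partition_UN)
    show "\<exists>P. triangle_partition E (T i) P" if "i \<in> I" for i
      using triangle_partition_singleton T[OF that] by blast
    show "T i \<inter> T j = {}" if ij: "i \<in> I" "j \<in> I" "i \<noteq> j" for i j
    proof (rule ccontr)
      assume "T i \<inter> T j \<noteq> {}"
      then obtain v where v: "v \<in> T i" "v \<in> T j" by auto
      have "\<exists>s<3. v = f (3 * l + s)" if "v \<in> T l" for l
      proof -
        have "v = f (3 * l + 0) \<or> v = f (3 * l + 1) \<or> v = f (3 * l + 2)" using that by (simp add: T_def)
        moreover have "(0::nat) < 3" "(1::nat) < 3" "(2::nat) < 3" by auto
        ultimately show ?thesis by blast
      qed
      with v obtain s t where st: "s < 3" "t < 3" "v = f (3 * i + s)" "v = f (3 * j + t)" by blast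
      then have "(3 * i + s) div 3 \<noteq> (3 * j + t) div 3" using ij by auto
      moreover have "i < r" "j < r" using ij by (auto simp: I_def)
      ultimately have "f (3 * i + s) = n"
        using ok[of "3 * i + s" "3 * j + t"] st by (auto simp: pair_ok_def)
      then show False using T(2)[OF ij(1)] v st by auto
    qed
  qed (simp add: I_def)
  then obtain P where P: "triangle_partition E (\<Union>i\<in>I. T i) P" ..
  have "\<exists>P. triangle_partition E (\<Union>a\<in>{..<k}. C a) P"
  proof (rule triangle_partition_UN)
    show "\<exists>P. triangle_partition E (C a) P" for a
    proof (rule clique_triangle_partition)
      show "3 dvd card (C a)" using g by (simp add: good_choice_def C_def)
    qed (use inst in \<open>auto simp: C_def clique_partition_instance_def\<close>)
  qed (auto simp: C_def)
  then obtain R where R: "triangle_partition E (\<Union>a\<in>{..<k}. C a) R" ..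
  have dj: "(\<Union>i\<in>I. T i) \<inter> (\<Union>a\<in>{..<k}. C a) = {}"
    by (auto simp: T_def C_def I_def)
  have un: "(\<Union>i\<in>I. T i) \<union> (\<Union>a\<in>{..<k}. C a) = {0..<n}" (is "?L = ?R")
  proof
    show "?L \<subseteq> ?R" using T(2) by (auto simp: C_def)
    show "?R \<subseteq> ?L"
    proof
      fix v assume "v \<in> ?R"
      then show "v \<in> ?L" using inst cover[of v]
        by (cases "v \<in> f ` {..<3 * r}") (auto simp: C_def clique_partition_instance_def)
    qed
  qed
  show ?thesis using triangle_partition_Un[OF P R dj]
    unfolding un triangle_partitionable_def triangle_partition_def by blast
qed

text \<open>The non-monochromatic triangles fill the first blocks. What remains of a colour is a
  union of monochromatic triangles, hence of size divisible by 3.\<close>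

lemma good_choice_if_triangle_partitionable:
  assumes inst: "clique_partition_instance k n E col" and tp: "triangle_partitionable n E"
  obtains f where "\<And>p. f p \<le> n" "good_choice n E col (6 * k ^ 3) f"
proof -
  obtain P where P: "triangle_partition E {0..<n} P" and few: "card {t \<in> P. \<not> monochromatic col t} \<le> 2 * k ^ 3"
    by (rule few_nonmonochromatic_triangles[OF assms])
  note tri = triangle_partitionD(1)[OF P] and PX = triangle_partitionD(2)[OF P]
    and dj = triangle_partitionD(4)[OF P]
  have finP: "finite P" using P by (auto simp: triangle_partition_def intro: finite_elements)
  define B where "B = {t \<in> P. \<not> monochromatic col t}"
  have "finite B" using finP by (simp add: B_def)
  then obtain h where h: "bij_betw h {0..<card B} B"
    using ex_bij_betw_nat_finite by blast
  have hB: "h i \<in> B" if "i < card B" for i using bij_betw_apply[OF h] that by simp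
  have "\<exists>e. bij_betw e {0..<3::nat} t" if "t \<in> P" for t
  proof -
    have t: "card t = 3" using tri[OF that] by simp
    then have "finite t" by (intro card_ge_0_finite) simp
    then show ?thesis using ex_bij_betw_nat_finite[of t] t by simp
  qed
  then obtain e where e: "\<And>t. t \<in> P \<Longrightarrow> bij_betw (e t) {0..<3::nat} t" by metis
  \<comment> \<open>Position \<open>p\<close> is vertex \<open>p mod 3\<close> of triangle
    \<open>p div 3\<close>; blocks from \<open>card B\<close> on are left empty.\<close>
  define f where "f p = (if p div 3 < card B then e (h (p div 3)) (p mod 3) else n)" for p
  have eB: "e (h i) j \<in> h i" if "i < card B" "j < 3" for i j
    using bij_betw_apply[OF e[of "h i"]] hB[OF that(1)] that by (simp add: B_def)
  have fn: "f p < n" if "p div 3 < card B" for p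
    using eB[of "p div 3" "p mod 3"] hB[OF that] PX that by (fastforce simp: f_def B_def)
  have fle: "f p \<le> n" for p using fn[of p] by (cases "p div 3 < card B") (auto simp: f_def)
  have ok: "pair_ok n E (p div 3 = q div 3) (f p) (f q)" if pq: "p \<noteq> q" for p q
  proof (cases "p div 3 < card B")
    case pB: True
    let ?t = "h (p div 3)"
    have tP: "?t \<in> P" using hB[OF pB] by (simp add: B_def)
    have pt: "f p \<in> ?t" using eB[OF pB] by (simp add: f_def pB)
    show ?thesis
    proof (cases "p div 3 = q div 3")
      case True
      then have "p mod 3 \<noteq> q mod 3" using pq by (metis div_mult_mod_eq)
      moreover have "inj_on (e ?t) {0..<3}" using e[OF tP] by (simp add: bij_betw_def)
      ultimately have "f p \<noteq> f q" using True pB by (auto simp: f_def dest: inj_onD)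
      moreover have "f q \<in> ?t" using eB[of "q div 3" "q mod 3"] True pB by (simp add: f_def)
      ultimately have "E (f p) (f q)" using tri[OF tP] pt by blast
      then show ?thesis using True pB fn[of p] fn[of q] by (simp add: pair_ok_def)
    next
      case False
      have "f p \<noteq> f q"
      proof (cases "q div 3 < card B")
        case True
        have "h (q div 3) \<noteq> ?t"
          using inj_onD[OF bij_betw_imp_inj_on[OF h], of "q div 3" "p div 3"] False True pB by auto
        moreover have "f q \<in> h (q div 3)" using eB[OF True] by (simp add: f_def True)
        moreover have "h (q div 3) \<in> P" using hB[OF True] by (simp add: B_def)
        ultimately show ?thesis using dj[OF tP] pt by metis
      next
        case qB: False
        then show ?thesis using fn[OF pB] by (simp add: f_def)
      qed
      with False show ?thesis by (simp add: pair_ok_def)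
    qed
  next
    case False
    then show ?thesis by (auto simp: pair_ok_def f_def)
  qed
  have img: "v \<in> f ` {..<6 * k ^ 3} \<longleftrightarrow> v \<in> \<Union>B" if "v < n" for v
  proof
    assume "v \<in> f ` {..<6 * k ^ 3}"
    then obtain p where p: "v = f p" by auto
    then have "p div 3 < card B" using that by (auto simp: f_def split: if_splits)
    then show "v \<in> \<Union>B" using eB[of "p div 3" "p mod 3"] hB p by (auto simp: f_def)
  next
    assume "v \<in> \<Union>B"
    then obtain t where t: "t \<in> B" "v \<in> t" by blast
    have "t \<in> h ` {0..<card B}" using t h by (simp add: bij_betw_imp_surj_on)
    then obtain i where i: "i < card B" "t = h i" by auto
    have "v \<in> e t ` {0..<3}" using t bij_betw_imp_surj_on[OF e[of t]] by (simp add: B_def)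
    then obtain j where j: "j < 3" "v = e t j" by auto
    have d: "(3 * i + j) div 3 = i" "(3 * i + j) mod 3 = j" using j by auto
    have "v = f (3 * i + j)" unfolding f_def d using i j by simp
    moreover have "3 * i + j < 6 * k ^ 3" using i j few by (simp add: B_def)
    ultimately show "v \<in> f ` {..<6 * k ^ 3}" by blast
  qed
  have "3 dvd card {v. v < n \<and> col v = a \<and> v \<notin> f ` {..<6 * k ^ 3}}" for a
  proof -
    define A where "A = {t \<in> P. monochromatic col t \<and> (\<forall>v\<in>t. col v = a)}"
    have U: "v < n \<longleftrightarrow> v \<in> \<Union>P" for v
      using triangle_partitionD(3)[OF P] by auto
    have "{v. v < n \<and> col v = a \<and> v \<notin> f ` {..<6 * k ^ 3}} = {v. v < n \<and> col v = a \<and> v \<notin> \<Union>B}"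
      using img by blast
    also have "\<dots> = \<Union>A"
    proof (intro equalityI subsetI)
      fix v assume v: "v \<in> {v. v < n \<and> col v = a \<and> v \<notin> \<Union>B}"
      then obtain t where t: "t \<in> P" "v \<in> t" using U by auto
      then have "monochromatic col t" using v by (auto simp: B_def)
      then show "v \<in> \<Union>A" using t v unfolding A_def monochromatic_def by blast
    next
      fix v assume "v \<in> \<Union>A"
      then obtain t where t: "t \<in> P" "monochromatic col t" "\<forall>v\<in>t. col v = a" "v \<in> t" by (auto simp: A_def)
      moreover have "v \<notin> \<Union>B" using dj t by (auto simp: B_def)
      ultimately show "v \<in> {v. v < n \<and> col v = a \<and> v \<notin> \<Union>B}" using U by auto
    qed
    finally have eq: "{v. v < n \<and> col v = a \<and> v \<notin> f ` {..<6 * k ^ 3}} = \<Union>A" .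
    have "card (\<Union>A) = (\<Sum>t\<in>A. card t)"
    proof (rule card_Union_disjoint)
      show "pairwise disjnt A" using dj unfolding pairwise_def disjnt_def A_def by blast
      show "finite t" if "t \<in> A" for t using tri[of t] that by (intro card_ge_0_finite) (simp add: A_def)
    qed
    also have "\<dots> = (\<Sum>t\<in>A. 3)" by (rule sum.cong) (use tri in \<open>auto simp: A_def\<close>)
    finally show ?thesis unfolding eq by simp
  qed
  with ok have "good_choice n E col (6 * k ^ 3) f" unfolding good_choice_def by blast
  then show thesis using that fle by blast
qed

theorem triangle_partitionable_iff_good_choice:
  assumes "clique_partition_instance k n E col"
  shows "triangle_partitionable n E \<longleftrightarrow> (\<exists>f. (\<forall>p. f p \<le> n) \<and> good_choice n E col (6 * k ^ 3) f)"
proof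
  assume "triangle_partitionable n E"
  then show "\<exists>f. (\<forall>p. f p \<le> n) \<and> good_choice n E col (6 * k ^ 3) f"
    using good_choice_if_triangle_partitionable[OF assms] by metis
next
  assume "\<exists>f. (\<forall>p. f p \<le> n) \<and> good_choice n E col (6 * k ^ 3) f"
  then obtain f where f: "\<And>p. f p \<le> n" "good_choice n E col (3 * (2 * k ^ 3)) f" by auto
  show "triangle_partitionable n E" by (rule triangle_partitionable_if_good_choice[OF assms f])
qed

section \<open>Simulating marked-cell register machines\<close>

definition nth0 :: "nat list \<Rightarrow> nat \<Rightarrow> nat" where
  "nth0 xs i = (if i < length xs then xs ! i else 0)"

lemma nth0_simps [simp]:
  "nth0 [] i = 0" "nth0 (x # xs) 0 = x" "nth0 (x # xs) (Suc i) = nth0 xs i"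
  by (auto simp: nth0_def)

lemma nth0_tl: "nth0 (tl xs) i = nth0 xs (Suc i)"
  by (cases xs) auto

fun shift :: "move \<Rightarrow> int" where
  "shift MoveL = -1" | "shift MoveR = 1" | "shift Stay = 0"

text \<open>A configuration lists cells relative to the head and may drop trailing blanks. The
  absolute position \<open>i\<close> and the tape \<open>T\<close> on all integers exist only in the
  proof; they keep cells comparable across moves.\<close>

definition repr :: "config \<Rightarrow> nat \<Rightarrow> int \<Rightarrow> (int \<Rightarrow> nat) \<Rightarrow> bool" where
  "repr cfg q i T \<longleftrightarrow> fst cfg = q \<and> (\<forall>j. T (i + int j) = nth0 (snd (snd cfg)) j) \<and>
     (\<forall>j. T (i - 1 - int j) = nth0 (fst (snd cfg)) j)"

lemma repr_step:
  assumes r: "repr (q, ls, rs) q i T" and q: "q \<noteq> acc_state M" "q \<noteq> rej_state M"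
    and d: "delta M q (T i) = (q', c, m)"
  shows "repr (step M (q, ls, rs)) q' (i + shift m) (T(i := c))"
proof -
  have R: "T (i + int j) = nth0 rs j" and L: "T (i - 1 - int j) = nth0 ls j" for j
    using r by (auto simp: repr_def)
  have hd: "(case rs of [] \<Rightarrow> 0 | x # _ \<Rightarrow> x) = T i"
    using R[of 0] by (cases rs) auto
  have R': "T (i + 1 + int j) = nth0 (tl rs) j" for j
    using R[of "Suc j"] by (simp add: nth0_tl algebra_simps)
  show ?thesis
  proof (cases m)
    case MoveL
    have l0: "T (i - 1) = nth0 ls 0" using L[of 0] by simp
    have "(T(i := c)) (i - 1 + int j) = nth0 (nth0 ls 0 # c # tl rs) j" for j
    proof (cases j)
      case (Suc j')
      then show ?thesis using R'[of "j' - 1"] by (cases j') (auto simp: algebra_simps)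
    qed (simp add: l0)
    moreover have "(T(i := c)) (i - 2 - int j) = nth0 (tl ls) j" for j
      using L[of "Suc j"] by (simp add: nth0_tl algebra_simps)
    ultimately show ?thesis
      using q d MoveL by (cases ls) (auto simp: repr_def hd)
  next
    case MoveR
    have "(T(i := c)) (i - int j) = nth0 (c # ls) j" for j
      using L[of "j - 1"] by (cases j) (auto simp: algebra_simps)
    then show ?thesis
      using q d MoveR R' by (auto simp: repr_def hd)
  next
    case Stay
    have "(T(i := c)) (i + int j) = nth0 (c # tl rs) j" for j
      using R'[of "j - 1"] by (cases j) (auto simp: algebra_simps)
    then show ?thesis
      using q d Stay L by (auto simp: repr_def hd)
  qed
qed

fun astep :: "('s \<Rightarrow> nat \<Rightarrow> 's \<times> nat \<times> move) \<Rightarrow> 's set \<Rightarrow> 's \<times> int \<times> (int \<Rightarrow> nat) \<Rightarrow> 's \<times> int \<times> (int \<Rightarrow> nat)"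
  where "astep D F (s, i, T) =
    (if s \<in> F then (s, i, T) else case D s (T i) of (s', c, m) \<Rightarrow> (s', i + shift m, T(i := c)))"

definition input_tape :: "nat list \<Rightarrow> int \<Rightarrow> nat" where
  "input_tape xs i = (if 0 \<le> i then nth0 xs (nat i) else 0)"

text \<open>A finite set of states of any type is renumbered to fit the machine model. The
  simulation is step for step, so running times carry over unchanged.\<close>

lemma tm_of_abstract_machine:
  fixes D :: "'s \<Rightarrow> nat \<Rightarrow> 's \<times> nat \<times> move"
  assumes fin: "finite S" and mem: "s0 \<in> S" "yes \<in> S" "no \<in> S" "yes \<noteq> no"
    and A: "4 \<le> A"
    and closed: "\<And>s a s' c m. s \<in> S \<Longrightarrow> a < A \<Longrightarrow> D s a = (s', c, m) \<Longrightarrow> s' \<in> S \<and> c < A"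
  obtains M where "wf_tm M"
    and "\<And>t xs. set xs \<subseteq> {..<A} \<Longrightarrow>
      halted M (run M t xs) \<longleftrightarrow> fst ((astep D {yes, no} ^^ t) (s0, 0, input_tape xs)) \<in> {yes, no}"
    and "\<And>t xs. set xs \<subseteq> {..<A} \<Longrightarrow>
      accepted M (run M t xs) \<longleftrightarrow> fst ((astep D {yes, no} ^^ t) (s0, 0, input_tape xs)) = yes"
proof -
  obtain g where g: "bij_betw g (S - {s0}) {0..<card (S - {s0})}"
    using ex_bij_betw_finite_nat[of "S - {s0}"] fin by auto
  \<comment> \<open>Every machine starts in state 0, so \<open>s0\<close> gets 0 and the other
    numbers are shifted by one.\<close>
  define h where "h s = (if s = s0 then 0 else Suc (g s))" for s
  have h0: "h s0 = 0" by (simp add: h_def)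
  have inj: "inj_on h S"
  proof (rule inj_onI)
    fix x y assume xy: "x \<in> S" "y \<in> S" "h x = h y"
    show "x = y"
    proof (cases "x = s0 \<or> y = s0")
      case True
      then show ?thesis using xy by (auto simp: h_def split: if_splits)
    next
      case False
      then have "g x = g y" using xy by (simp add: h_def)
      then show ?thesis using False xy g by (auto simp: bij_betw_def dest: inj_onD)
    qed
  qed
  have hS: "h ` S = {..<card S}"
  proof -
    have "card S = Suc (card (S - {s0}))" by (rule card.remove[OF fin mem(1)])
    moreover have "h ` S = insert 0 (Suc ` (g ` (S - {s0})))"
      using mem by (force simp: h_def)
    moreover have "g ` (S - {s0}) = {0..<card (S - {s0})}" using g by (simp add: bij_betw_def)
    ultimately show ?thesis by (simp add: lessThan_Suc_eq_insert_0 atLeast0LessThan)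
  qed
  have hb: "h s < card S" if "s \<in> S" for s using hS that by auto
  define k where "k = inv_into S h"
  have kh: "k (h s) = s" if "s \<in> S" for s using inj that by (simp add: k_def)
  have kS: "k q \<in> S" if "q < card S" for q using hS that by (auto simp: k_def intro: inv_into_into)
  define M where "M = \<lparr>nstates = card S, nsyms = A,
    delta = (\<lambda>q a. case D (k q) a of (s', c, m) \<Rightarrow> (h s', c, m)), acc_state = h yes, rej_state = h no\<rparr>"
  have "card S > 0" using fin mem by (auto simp: card_gt_0_iff)
  moreover have "h yes \<noteq> h no" using inj mem by (auto dest: inj_onD)
  moreover have "case delta M q s of (q', s', _) \<Rightarrow> q' < nstates M \<and> s' < nsyms M"
    if "q < nstates M" "s < nsyms M" for q s
  proof -
    obtain s' c m where d: "D (k q) s = (s', c, m)" by (metis prod_cases3)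
    with closed[OF kS _ d] that show ?thesis by (simp add: M_def hb)
  qed
  ultimately have wf: "wf_tm M" using A mem hb unfolding wf_tm_def by (simp add: M_def)
  have inv: "\<exists>s i T. (astep D {yes, no} ^^ t) (s0, 0, input_tape xs) = (s, i, T) \<and> s \<in> S \<and>
     (\<forall>i. T i < A) \<and> repr (run M t xs) (h s) i T" if xs: "set xs \<subseteq> {..<A}" for t xs
  proof (induction t)
    case 0
    have "input_tape xs i < A" for i
      using xs A by (auto simp: input_tape_def nth0_def subset_iff)
    moreover have "repr (run M 0 xs) 0 0 (input_tape xs)"
      by (simp add: repr_def run_def input_tape_def)
    ultimately show ?case using mem h0 by simp
  next
    case (Suc t)
    then obtain s i T where IH: "(astep D {yes, no} ^^ t) (s0, 0, input_tape xs) = (s, i, T)"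
      "s \<in> S" "\<forall>i. T i < A" "repr (run M t xs) (h s) i T" by blast
    obtain ls rs where cfg: "run M t xs = (h s, ls, rs)"
      using IH(4) by (metis repr_def prod.collapse)
    have step: "run M (Suc t) xs = step M (h s, ls, rs)"
      using cfg by (simp add: run_def)
    show ?case
    proof (cases "s \<in> {yes, no}")
      case True
      then have "step M (h s, ls, rs) = (h s, ls, rs)" by (auto simp: M_def)
      with True IH cfg step show ?thesis by auto
    next
      case False
      obtain s' c m where d: "D s (T i) = (s', c, m)" by (metis prod_cases3)
      have ne: "h s \<noteq> acc_state M" "h s \<noteq> rej_state M"
        using False inj IH(2) mem by (auto simp: M_def dest: inj_onD)
      have "delta M (h s) (T i) = (h s', c, m)" using d IH(2) by (simp add: M_def kh)
      from repr_step[OF IH(4)[unfolded cfg] ne this] have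
        "repr (run M (Suc t) xs) (h s') (i + shift m) (T(i := c))" by (simp add: step)
      moreover have "s' \<in> S \<and> c < A" using closed[OF IH(2) _ d] IH(3) by simp
      ultimately show ?thesis using IH(1,3) False d by auto
    qed
  qed
  have fin_iff: "h s = h s' \<longleftrightarrow> s = s'" if "s \<in> S" "s' \<in> S" for s s'
    using inj that by (auto dest: inj_onD)
  show thesis
  proof (rule that[OF wf])
    fix t :: nat and xs :: "nat list" assume "set xs \<subseteq> {..<A}"
    from inv[OF this, of t] obtain s i T where *: "(astep D {yes, no} ^^ t) (s0, 0, input_tape xs) = (s, i, T)"
      "s \<in> S" "repr (run M t xs) (h s) i T" by blast
    then have "fst (run M t xs) = h s" by (simp add: repr_def)
    with * show "halted M (run M t xs) \<longleftrightarrow> fst ((astep D {yes, no} ^^ t) (s0, 0, input_tape xs)) \<in> {yes, no}"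
      and "accepted M (run M t xs) \<longleftrightarrow> fst ((astep D {yes, no} ^^ t) (s0, 0, input_tape xs)) = yes"
      using mem by (auto simp: halted_def accepted_def M_def fin_iff)
  qed
qed

section \<open>Tape symbols with marks\<close>

text \<open>The base symbol occupies the two lowest binary digits, the set of marks the higher ones.
  Thus \<open>mk_sym b {} = b\<close>, and the raw input already is a tape without marks.\<close>

definition mk_sym :: "nat \<Rightarrow> nat set \<Rightarrow> nat" where
  "mk_sym b A = b + 4 * set_encode A"

definition base_sym :: "nat \<Rightarrow> nat" where
  "base_sym s = s mod 4"

definition marks :: "nat \<Rightarrow> nat set" where
  "marks s = set_decode (s div 4)"

lemma base_mk_sym [simp]: "b < 4 \<Longrightarrow> base_sym (mk_sym b A) = b"
  by (simp add: base_sym_def mk_sym_def)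

lemma marks_mk_sym [simp]: "b < 4 \<Longrightarrow> finite A \<Longrightarrow> marks (mk_sym b A) = A"
  by (simp add: marks_def mk_sym_def)

lemma mk_sym_bound: "b < 4 \<Longrightarrow> A \<subseteq> {..<H} \<Longrightarrow> mk_sym b A < 4 * 2 ^ H"
proof -
  assume b: "b < 4" and A: "A \<subseteq> {..<H}"
  have "set_encode A \<le> set_encode {..<H}"
    unfolding set_encode_def by (rule sum_mono2) (use A in auto)
  also have "\<dots> = 2 ^ H - 1" by (simp add: set_encode_def mask_eq_sum_exp_nat lessThan_def)
  finally have "set_encode A < 2 ^ H"
    by (metis Suc_pred' le_imp_less_Suc zero_less_numeral zero_less_power)
  with b show ?thesis by (simp add: mk_sym_def)
qed

lemma base_sym_bound [simp]: "base_sym s < 4"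
  by (simp add: base_sym_def)

lemma marks_bound: "s < 4 * 2 ^ H \<Longrightarrow> marks s \<subseteq> {..<H}"
proof
  fix h assume s: "s < 4 * 2 ^ H" and h: "h \<in> marks s"
  then have "odd ((s div 4) div 2 ^ h)" by (simp add: marks_def set_decode_def)
  then have "2 ^ h \<le> s div 4"
    by (metis div_less even_zero not_less)
  also have "\<dots> < 2 ^ H" using s by auto
  finally show "h \<in> {..<H}" by simp
qed

section \<open>Register machines and their simulation by sweeps\<close>

datatype action = ANop | AInc | AZero

definition cell :: "nat list \<Rightarrow> nat \<Rightarrow> nat" where
  "cell w i = nth0 w i"

text \<open>Increments saturate at \<open>length w\<close>, the blank directly behind the word: it
  is the rightmost cell that may carry marks.\<close>

fun apply_act :: "nat list \<Rightarrow> action \<Rightarrow> nat \<Rightarrow> (nat \<Rightarrow> nat) \<Rightarrow> nat \<Rightarrow> nat" where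
  "apply_act w ANop x \<sigma> = \<sigma>"
| "apply_act w AInc x \<sigma> = (if \<sigma> x < length w then \<sigma>(x := Suc (\<sigma> x)) else \<sigma>)"
| "apply_act w AZero x \<sigma> = \<sigma>(x := 0)"

text \<open>A register step is a sweep from cell 0 to a mark and back. \<open>Seek\<close> finds the
  mark of the register, \<open>Put\<close> sets a lifted mark down one cell further right,
  \<open>RetZ\<close> and \<open>PutZ\<close> take it to cell 0, and \<open>Ret\<close> merely
  returns. The blank at cell -1 signals the left end; returns start to the left of the blank behind
  the word, so the two blanks are not confused.\<close>

datatype 'q mstate = Init | Seek 'q | Ret 'q | Put nat 'q | RetZ nat 'q | PutZ nat 'q

text \<open>A step inspects one register and learns what stands on its cell: the base symbol and the
  set of registers with the same value. Equality tests are therefore free, and nothing else about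
  the values is observable.\<close>

locale register_machine =
  fixes rd :: "'q \<Rightarrow> nat" and nxt :: "'q \<Rightarrow> nat \<Rightarrow> nat set \<Rightarrow> action \<times> 'q"
    and H :: nat and Q :: "'q set" and q0 yes no :: 'q
  assumes Q: "finite Q" "q0 \<in> Q" "yes \<in> Q" "no \<in> Q" "yes \<noteq> no"
    and rd_bound: "q \<in> Q \<Longrightarrow> rd q < H"
    and nxt_closed: "q \<in> Q \<Longrightarrow> snd (nxt q b A) \<in> Q"
    and nxt_final: "nxt yes b A = (ANop, yes)" "nxt no b A = (ANop, no)"
begin

fun rstep :: "nat list \<Rightarrow> 'q \<times> (nat \<Rightarrow> nat) \<Rightarrow> 'q \<times> (nat \<Rightarrow> nat)" where
  "rstep w (q, \<sigma>) = (case nxt q (cell w (\<sigma> (rd q))) {h. h < H \<and> \<sigma> h = \<sigma> (rd q)} of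
     (a, q') \<Rightarrow> (q', apply_act w a (rd q) \<sigma>))"

fun mdelta :: "'q mstate \<Rightarrow> nat \<Rightarrow> 'q mstate \<times> nat \<times> move" where
  "mdelta Init s = (Seek q0, mk_sym (base_sym s) {..<H}, Stay)"
| "mdelta (Seek q) s = (if rd q \<notin> marks s then (Seek q, s, MoveR) else
     (case nxt q (base_sym s) (marks s) of (a, q') \<Rightarrow> case a of
        ANop \<Rightarrow> (Ret q', s, MoveL)
      | AInc \<Rightarrow> if base_sym s = 0 then (Ret q', s, MoveL)
          else (Put (rd q) q', mk_sym (base_sym s) (marks s - {rd q}), MoveR)
      | AZero \<Rightarrow> (RetZ (rd q) q', mk_sym (base_sym s) (marks s - {rd q}), MoveL)))"
| "mdelta (Ret q) s = (if base_sym s = 0 then (Seek q, s, MoveR) else (Ret q, s, MoveL))"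
| "mdelta (Put x q) s = (Ret q, mk_sym (base_sym s) (insert x (marks s)), MoveL)"
| "mdelta (RetZ x q) s = (if base_sym s = 0 then (PutZ x q, s, MoveR) else (RetZ x q, s, MoveL))"
| "mdelta (PutZ x q) s = (Seek q, mk_sym (base_sym s) (insert x (marks s)), Stay)"

definition mstates :: "'q mstate set" where
  "mstates = {Init} \<union> Seek ` Q \<union> Ret ` Q \<union> case_prod Put ` ({..<H} \<times> Q) \<union>
     case_prod RetZ ` ({..<H} \<times> Q) \<union> case_prod PutZ ` ({..<H} \<times> Q)"

lemma mstates_iff [simp]:
  "Init \<in> mstates" "Seek q \<in> mstates \<longleftrightarrow> q \<in> Q" "Ret q \<in> mstates \<longleftrightarrow> q \<in> Q"
  "Put x q \<in> mstates \<longleftrightarrow> x < H \<and> q \<in> Q" "RetZ x q \<in> mstates \<longleftrightarrow> x < H \<and> q \<in> Q"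
  "PutZ x q \<in> mstates \<longleftrightarrow> x < H \<and> q \<in> Q"
  by (auto simp: mstates_def)

lemma mdelta_closed:
  assumes "s \<in> mstates" "a < 4 * 2 ^ H" "mdelta s a = (s', c, m)"
  shows "s' \<in> mstates \<and> c < 4 * 2 ^ H"
proof -
  have m: "marks a \<subseteq> {..<H}" using marks_bound assms(2) .
  have *: "mk_sym (base_sym a) A < 4 * 2 ^ H" if "A \<subseteq> {..<H}" for A
    using that by (simp add: mk_sym_bound)
  show ?thesis
  proof (cases s)
    case (Seek q)
    obtain b q' where n: "nxt q (base_sym a) (marks a) = (b, q')" by fastforce
    have "q' \<in> Q" "q \<in> Q" "rd q < H"
      using nxt_closed[of q "base_sym a" "marks a"] rd_bound[of q] assms(1) n Seek by auto
    moreover have "marks a - {rd q} \<subseteq> {..<H}" using m by auto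
    ultimately show ?thesis using assms Seek n *
      by (auto split: if_splits action.splits)
  qed (use assms m * Q in \<open>auto split: if_splits\<close>)
qed

abbreviation "mstep \<equiv> astep mdelta {Seek yes, Seek no}"

text \<open>A register with value \<open>Suc (length w)\<close> has no mark on the tape; this describes the
  initial tape and the moments at which a mark is being moved.\<close>

definition tape :: "nat list \<Rightarrow> (nat \<Rightarrow> nat) \<Rightarrow> int \<Rightarrow> nat" where
  "tape w \<sigma> i = (if 0 \<le> i \<and> i \<le> int (length w)
     then mk_sym (cell w (nat i)) {h. h < H \<and> \<sigma> h = nat i} else 0)"

context
  fixes w :: "nat list"
  assumes w: "set w \<subseteq> {1, 2, 3}"
begin

lemma cell_nonzero: "cell w i \<noteq> 0 \<longleftrightarrow> i < length w"
proof -
  have "w ! i \<in> {1,2,3}" if "i < length w" using w that nth_mem by blast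
  then show ?thesis by (auto simp: cell_def nth0_def)
qed

lemma cell_less [simp]: "cell w i < 4"
proof -
  have "w ! i \<in> {1,2,3}" if "i < length w" using w that nth_mem by blast
  then show ?thesis by (force simp: cell_def nth0_def)
qed

lemma base_tape: "base_sym (tape w \<sigma> i) = (if 0 \<le> i then cell w (nat i) else 0)"
  using cell_nonzero[of "nat i"] by (auto simp: tape_def base_sym_def[of 0])

lemma marks_tape: "0 \<le> i \<Longrightarrow> i \<le> int (length w) \<Longrightarrow> marks (tape w \<sigma> i) = {h. h < H \<and> \<sigma> h = nat i}"
  by (simp add: tape_def)

lemma tape_erase:
  assumes "\<sigma> x \<le> length w"
  shows "(tape w \<sigma>)(int (\<sigma> x) := mk_sym (cell w (\<sigma> x)) ({h. h < H \<and> \<sigma> h = \<sigma> x} - {x}))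
     = tape w (\<sigma>(x := Suc (length w)))"
  using assms by (auto simp: tape_def fun_eq_iff intro!: arg_cong[of _ _ "mk_sym _"])

lemma tape_put:
  assumes "\<sigma> x = Suc (length w)" "j \<le> length w" "x < H"
  shows "(tape w \<sigma>)(int j := mk_sym (base_sym (tape w \<sigma> (int j))) (insert x (marks (tape w \<sigma> (int j)))))
     = tape w (\<sigma>(x := j))"
  using assms by (auto simp: tape_def fun_eq_iff intro!: arg_cong[of _ _ "mk_sym _"])

lemma mstep_seek:
  assumes "x = rd q" "x < H" "\<sigma> x \<le> length w" "j \<le> \<sigma> x" "q \<noteq> yes" "q \<noteq> no"
  shows "(mstep ^^ (\<sigma> x - j)) (Seek q, int j, tape w \<sigma>) = (Seek q, int (\<sigma> x), tape w \<sigma>)"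
  using assms(4)
proof (induction "\<sigma> x - j" arbitrary: j)
  case 0
  then show ?case by simp
next
  case (Suc d)
  have "rd q \<notin> marks (tape w \<sigma> (int j))"
    using Suc assms by (subst marks_tape) auto
  then have "mstep (Seek q, int j, tape w \<sigma>) = (Seek q, int (Suc j), tape w \<sigma>)"
    using assms by simp
  moreover have "(mstep ^^ (\<sigma> x - Suc j)) (Seek q, int (Suc j), tape w \<sigma>) = (Seek q, int (\<sigma> x), tape w \<sigma>)"
    using Suc by (intro Suc.hyps) auto
  moreover have "\<sigma> x - j = Suc (\<sigma> x - Suc j)" using Suc.hyps(2) Suc.prems by simp
  ultimately show ?case by (simp only: funpow_Suc_right comp_apply)
qed

lemma mstep_ret:
  assumes "j \<le> length w"
  shows "(mstep ^^ Suc j) (Ret q, int j - 1, tape w \<sigma>) = (Seek q, 0, tape w \<sigma>)"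
  using assms
proof (induction j)
  case 0
  have "base_sym (tape w \<sigma> (-1)) = 0" by (simp add: base_tape)
  then show ?case by simp
next
  case (Suc j)
  have "base_sym (tape w \<sigma> (int j)) \<noteq> 0" using Suc.prems cell_nonzero[of j] by (simp add: base_tape)
  then have "mstep (Ret q, int (Suc j) - 1, tape w \<sigma>) = (Ret q, int j - 1, tape w \<sigma>)" by simp
  with Suc show ?case by (subst funpow_Suc_right) (simp del: astep.simps funpow.simps)
qed

lemma mstep_retz:
  assumes "j \<le> length w"
  shows "(mstep ^^ Suc j) (RetZ x q, int j - 1, tape w \<sigma>) = (PutZ x q, 0, tape w \<sigma>)"
  using assms
proof (induction j)
  case 0
  have "base_sym (tape w \<sigma> (-1)) = 0" by (simp add: base_tape)
  then show ?case by simp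
next
  case (Suc j)
  have "base_sym (tape w \<sigma> (int j)) \<noteq> 0" using Suc.prems cell_nonzero[of j] by (simp add: base_tape)
  then have "mstep (RetZ x q, int (Suc j) - 1, tape w \<sigma>) = (RetZ x q, int j - 1, tape w \<sigma>)" by simp
  with Suc show ?case by (subst funpow_Suc_right) (simp del: astep.simps funpow.simps)
qed

text \<open>With \<open>x\<close> the register read, the exact times are
  \<open>2 * \<sigma> x + 2\<close> if no mark moves, \<open>2 * \<sigma> x + 4\<close> for an
  increment, \<open>2 * \<sigma> x + 3\<close> for a reset, and 0 in a final state; the bound covers
  all of them.\<close>

lemma mstep_simulates_rstep:
  assumes q: "q \<in> Q" and \<sigma>: "\<And>h. h < H \<Longrightarrow> \<sigma> h \<le> length w"
    and r: "rstep w (q, \<sigma>) = (q', \<sigma>')"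
  shows "\<exists>t \<le> 2 * length w + 6. (mstep ^^ t) (Seek q, 0, tape w \<sigma>) = (Seek q', 0, tape w \<sigma>')"
proof (cases "q = yes \<or> q = no")
  case True
  then have "q' = q \<and> \<sigma>' = \<sigma>" using r nxt_final by auto
  then show ?thesis by (intro exI[of _ 0]) simp
next
  case False
  define x where "x = rd q"
  have x: "x < H" using rd_bound q by (simp add: x_def)
  have xl: "\<sigma> x \<le> length w" using \<sigma> x by simp
  let ?A = "{h. h < H \<and> \<sigma> h = \<sigma> x}"
  obtain a where n: "nxt q (cell w (\<sigma> x)) ?A = (a, q')" and \<sigma>': "\<sigma>' = apply_act w a x \<sigma>"
    using r by (auto simp: x_def split: prod.splits)
  have seek: "(mstep ^^ \<sigma> x) (Seek q, 0, tape w \<sigma>) = (Seek q, int (\<sigma> x), tape w \<sigma>)"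
    using mstep_seek[of x q \<sigma> 0] False x xl by (simp add: x_def)
  have b: "base_sym (tape w \<sigma> (int (\<sigma> x))) = cell w (\<sigma> x)" by (simp add: base_tape)
  have m: "marks (tape w \<sigma> (int (\<sigma> x))) = ?A" using xl by (simp add: marks_tape)
  have xA: "rd q \<in> ?A" using x by (simp add: x_def)
  let ?e = "\<sigma>(x := Suc (length w))"
  \<comment> \<open>A saturated increment leaves the tape alone and is treated like
    \<open>ANop\<close>.\<close>
  show ?thesis
  proof (cases "a = ANop \<or> a = AInc \<and> \<sigma> x = length w")
    case True
    have "a = AInc \<Longrightarrow> cell w (\<sigma> x) = 0" using True cell_nonzero[of "\<sigma> x"] by auto
    then have "mstep (Seek q, int (\<sigma> x), tape w \<sigma>) = (Ret q', int (\<sigma> x) - 1, tape w \<sigma>)"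
      using False True n b m xA by (auto split: action.splits)
    then have "(mstep ^^ Suc (\<sigma> x)) (Seek q, 0, tape w \<sigma>) = (Ret q', int (\<sigma> x) - 1, tape w \<sigma>)"
      by (simp only: funpow.simps(2) comp_apply seek)
    then have "(mstep ^^ (Suc (\<sigma> x) + Suc (\<sigma> x))) (Seek q, 0, tape w \<sigma>) = (Seek q', 0, tape w \<sigma>)"
      unfolding funpow_add comp_apply
      using mstep_ret[OF xl, of q' \<sigma>] by (simp only:)
    moreover have "\<sigma>' = \<sigma>" using \<sigma>' True by auto
    ultimately show ?thesis using xl by (intro exI[of _ "Suc (\<sigma> x) + Suc (\<sigma> x)"]) simp
  next
    case na: False
    show ?thesis
    proof (cases "a = AInc")
      case True
      then have lt: "\<sigma> x < length w" using na xl by auto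
      then have nz: "cell w (\<sigma> x) \<noteq> 0" using cell_nonzero by simp
      have 1: "mstep (Seek q, int (\<sigma> x), tape w \<sigma>) = (Put x q', int (Suc (\<sigma> x)), tape w ?e)"
        using False True n b m xA nz tape_erase[of \<sigma> x, OF xl] by (simp add: x_def)
      have 2: "mstep (Put x q', int (Suc (\<sigma> x)), tape w ?e) = (Ret q', int (Suc (\<sigma> x)) - 1, tape w \<sigma>')"
        using tape_put[of ?e x "Suc (\<sigma> x)"] x lt True \<sigma>' by simp
      have "(mstep ^^ (Suc (Suc (\<sigma> x)) + (Suc (Suc (\<sigma> x))))) (Seek q, 0, tape w \<sigma>) = (Seek q', 0, tape w \<sigma>')"
      proof -
        have "(mstep ^^ (Suc (Suc (\<sigma> x)))) (Seek q, 0, tape w \<sigma>) = (Ret q', int (Suc (\<sigma> x)) - 1, tape w \<sigma>')"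
          by (simp only: funpow.simps(2) comp_apply seek 1 2)
        then show ?thesis unfolding funpow_add comp_apply
          using mstep_ret[of "Suc (\<sigma> x)" q' \<sigma>'] lt by (simp del: astep.simps funpow.simps)
      qed
      then show ?thesis using lt by (intro exI[of _ "Suc (Suc (\<sigma> x)) + (Suc (Suc (\<sigma> x)))"]) (simp del: funpow.simps)
    next
      case nai: False
      then have az: "a = AZero" using na by (cases a) auto
      have 1: "mstep (Seek q, int (\<sigma> x), tape w \<sigma>) = (RetZ x q', int (\<sigma> x) - 1, tape w ?e)"
        using False az n b m xA tape_erase[of \<sigma> x, OF xl] by (simp add: x_def)
      have 2: "mstep (PutZ x q', 0, tape w ?e) = (Seek q', 0, tape w \<sigma>')"
        using tape_put[of ?e x 0] x az \<sigma>' by simp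
      have "(mstep ^^ (Suc (Suc (\<sigma> x) + Suc (\<sigma> x)))) (Seek q, 0, tape w \<sigma>) = (Seek q', 0, tape w \<sigma>')"
      proof -
        have "(mstep ^^ (Suc (\<sigma> x))) (Seek q, 0, tape w \<sigma>) = (RetZ x q', int (\<sigma> x) - 1, tape w ?e)"
          by (simp only: funpow.simps(2) comp_apply seek 1)
        then have "(mstep ^^ (Suc (\<sigma> x) + Suc (\<sigma> x))) (Seek q, 0, tape w \<sigma>) = (PutZ x q', 0, tape w ?e)"
          unfolding funpow_add comp_apply
          using mstep_retz[of "\<sigma> x" x q' ?e] xl by (simp del: astep.simps funpow.simps)
        then show ?thesis by (simp only: funpow.simps(2)[of "Suc (\<sigma> x) + Suc (\<sigma> x)"] comp_apply 2)
      qed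
      then show ?thesis using xl by (intro exI[of _ "Suc (Suc (\<sigma> x) + Suc (\<sigma> x))"]) (simp del: funpow.simps)
    qed
  qed
qed

lemma rstep_invariant:
  assumes "q \<in> Q" "\<And>h. h < H \<Longrightarrow> \<sigma> h \<le> length w" "rstep w (q, \<sigma>) = (q', \<sigma>')"
  shows "q' \<in> Q" "h < H \<Longrightarrow> \<sigma>' h \<le> length w"
proof -
  obtain a where n: "nxt q (cell w (\<sigma> (rd q))) {h. h < H \<and> \<sigma> h = \<sigma> (rd q)} = (a, q')"
    and \<sigma>': "\<sigma>' = apply_act w a (rd q) \<sigma>"
    using assms(3) by (auto split: prod.splits)
  show "q' \<in> Q" using nxt_closed[OF assms(1)] n by (metis snd_conv)
  show "h < H \<Longrightarrow> \<sigma>' h \<le> length w" using assms(2) \<sigma>' by (cases a) auto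
qed

lemma mstep_simulates_rsteps:
  assumes "(rstep w ^^ t) (q0, \<lambda>_. 0) = (q, \<sigma>)"
  shows "q \<in> Q \<and> (\<forall>h<H. \<sigma> h \<le> length w) \<and> (\<exists>t' \<le> t * (2 * length w + 6) + 1.
    (mstep ^^ t') (Init, 0, input_tape w) = (Seek q, 0, tape w \<sigma>))"
  using assms
proof (induction t arbitrary: q \<sigma>)
  case 0
  \<comment> \<open>\<open>Init\<close> sees the raw input, the tape of registers that all point
    beyond it. Its single step, the \<open>+ 1\<close> in the bound, puts every mark on cell
    0.\<close>
  have "input_tape w = tape w (\<lambda>_. Suc (length w))"
  proof
    fix x
    have e: "{h. h < H \<and> Suc (length w) = nat x} = {}" if "x \<le> int (length w)"
      using that by auto
    show "input_tape w x = tape w (\<lambda>_. Suc (length w)) x"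
      by (auto simp: input_tape_def tape_def mk_sym_def cell_def nth0_def e)
  qed
  moreover have "(tape w (\<lambda>_. Suc (length w)))(0 := mk_sym (cell w 0) {..<H}) = tape w (\<lambda>_. 0)"
    by (auto simp: tape_def fun_eq_iff intro!: arg_cong[of _ _ "mk_sym _"])
  ultimately have "mstep (Init, 0, input_tape w) = (Seek q0, 0, tape w (\<lambda>_. 0))"
    by (simp add: base_tape)
  then have "(mstep ^^ 1) (Init, 0, input_tape w) = (Seek q0, 0, tape w (\<lambda>_. 0))"
    by (simp del: astep.simps)
  moreover have "q = q0" "\<sigma> = (\<lambda>_. 0)" using 0 by auto
  ultimately show ?case using Q by (auto simp del: astep.simps intro!: exI[of _ 1])
next
  case (Suc t)
  obtain q1 \<sigma>1 where 1: "(rstep w ^^ t) (q0, \<lambda>_. 0) = (q1, \<sigma>1)" by fastforce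
  then have 2: "rstep w (q1, \<sigma>1) = (q, \<sigma>)" using Suc.prems by simp
  from Suc.IH[OF 1] obtain t' where IH: "q1 \<in> Q" "\<forall>h<H. \<sigma>1 h \<le> length w"
    "t' \<le> t * (2 * length w + 6) + 1"
    "(mstep ^^ t') (Init, 0, input_tape w) = (Seek q1, 0, tape w \<sigma>1)" by blast
  from mstep_simulates_rstep[OF IH(1) _ 2] IH(2) obtain u where u: "u \<le> 2 * length w + 6"
    "(mstep ^^ u) (Seek q1, 0, tape w \<sigma>1) = (Seek q, 0, tape w \<sigma>)" by blast
  have "(mstep ^^ (u + t')) (Init, 0, input_tape w) = (Seek q, 0, tape w \<sigma>)"
    unfolding funpow_add comp_apply using IH u by (simp del: astep.simps)
  moreover have "u + t' \<le> Suc t * (2 * length w + 6) + 1" using u IH by simp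
  ultimately show ?case using rstep_invariant[OF IH(1) _ 2] IH(2) by blast
qed

end

text \<open>\<open>T\<close> may exceed the simulated time because halted configurations no longer
  change; so an upper bound on the running time can serve as the time of inspection.\<close>

theorem tm_of_register_machine:
  obtains M where "wf_tm M"
    and "\<And>w t T \<sigma> b. set w \<subseteq> {1, 2, 3} \<Longrightarrow>
      (rstep w ^^ t) (q0, \<lambda>_. 0) = ((if b then yes else no), \<sigma>) \<Longrightarrow>
      t * (2 * length w + 6) + 1 \<le> T \<Longrightarrow>
      halted M (run M T w) \<and> (accepted M (run M T w) \<longleftrightarrow> b)"
proof -
  have fin: "finite mstates" using Q by (simp add: mstates_def)
  have mem: "Init \<in> mstates" "Seek yes \<in> mstates" "Seek no \<in> mstates" "Seek yes \<noteq> Seek no" using Q by auto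
  have 4: "4 \<le> 4 * (2::nat) ^ H" by simp
  show thesis
  proof (rule tm_of_abstract_machine[where D = mdelta, OF fin mem 4])
    show "s' \<in> mstates \<and> c < 4 * 2 ^ H" if "s \<in> mstates" "a < 4 * 2 ^ H" "mdelta s a = (s', c, m)" for s a s' c m
      using mdelta_closed that .
  next
    fix M
    assume M: "wf_tm M"
      "\<And>t xs. set xs \<subseteq> {..<4 * 2 ^ H} \<Longrightarrow>
        halted M (run M t xs) \<longleftrightarrow> fst ((mstep ^^ t) (Init, 0, input_tape xs)) \<in> {Seek yes, Seek no}"
      "\<And>t xs. set xs \<subseteq> {..<4 * 2 ^ H} \<Longrightarrow>
        accepted M (run M t xs) \<longleftrightarrow> fst ((mstep ^^ t) (Init, 0, input_tape xs)) = Seek yes"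
    show thesis
    proof (rule that[OF M(1)])
      fix w t T \<sigma> b
      assume w: "set w \<subseteq> {1, 2, 3::nat}" and
        r: "(rstep w ^^ t) (q0, \<lambda>_. 0) = ((if b then yes else no), \<sigma>)" and
        T: "t * (2 * length w + 6) + 1 \<le> T"
      from mstep_simulates_rsteps[OF w r] T obtain t' where t': "t' \<le> T"
        "(mstep ^^ t') (Init, 0, input_tape w) = (Seek (if b then yes else no), 0, tape w \<sigma>)"
        by (meson order_trans)
      have stay: "(mstep ^^ n) (Seek (if b then yes else no), 0, tape w \<sigma>) =
        (Seek (if b then yes else no), 0, tape w \<sigma>)" for n
        by (induction n) auto
      have "(mstep ^^ (T - t' + t')) (Init, 0, input_tape w) = (Seek (if b then yes else no), 0, tape w \<sigma>)"
        unfolding funpow_add comp_apply t'(2) by (rule stay)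
      then have f: "(mstep ^^ T) (Init, 0, input_tape w) = (Seek (if b then yes else no), 0, tape w \<sigma>)"
        using t'(1) by simp
      have "set w \<subseteq> {..<4}" using w by auto
      also have "\<dots> \<subseteq> {..<4 * 2 ^ H}" using 4 by (simp only: lessThan_subset_iff)
      finally have "set w \<subseteq> {..<4 * 2 ^ H}" .
      with M(2,3) f Q show "halted M (run M T w) \<and> (accepted M (run M T w) \<longleftrightarrow> b)"
        by auto
    qed
  qed
qed

end

section \<open>For-loop programs\<close>

datatype tst = Cell nat | At nat

fun holds :: "tst \<Rightarrow> nat \<Rightarrow> nat set \<Rightarrow> bool" where
  "holds (Cell s) b A \<longleftrightarrow> b = s"
| "holds (At y) b A \<longleftrightarrow> y \<in> A"

fun sat :: "nat list \<Rightarrow> tst \<Rightarrow> nat \<Rightarrow> (nat \<Rightarrow> nat) \<Rightarrow> bool" where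
  "sat w (Cell s) x \<sigma> \<longleftrightarrow> cell w (\<sigma> x) = s"
| "sat w (At y) x \<sigma> \<longleftrightarrow> \<sigma> y = \<sigma> x"

datatype prog = Skip | Inc nat | Zero nat | Seq prog prog
  | Cond nat tst prog prog | Rep nat tst prog

definition stop :: "nat list \<Rightarrow> tst \<Rightarrow> nat \<Rightarrow> (nat \<Rightarrow> nat) \<Rightarrow> bool" where
  "stop w c x \<sigma> \<longleftrightarrow> sat w c x \<sigma> \<or> length w \<le> \<sigma> x"

abbreviation inc :: "nat list \<Rightarrow> nat \<Rightarrow> (nat \<Rightarrow> nat) \<Rightarrow> nat \<Rightarrow> nat" where
  "inc w x \<sigma> \<equiv> apply_act w AInc x \<sigma>"

text \<open>\<open>Rep\<close> iterates a fixed number of times, which makes \<open>exec\<close>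
  total by primitive recursion. Once \<open>stop\<close> holds the iteration is stationary. Under
  \<open>wf_prog\<close> the body leaves \<open>x\<close> alone, so every earlier round raises
  \<open>x\<close> by one and \<open>length w\<close> rounds suffice.\<close>

primrec exec :: "nat list \<Rightarrow> prog \<Rightarrow> (nat \<Rightarrow> nat) \<Rightarrow> nat \<Rightarrow> nat" where
  "exec w Skip \<sigma> = \<sigma>"
| "exec w (Inc x) \<sigma> = inc w x \<sigma>"
| "exec w (Zero x) \<sigma> = \<sigma>(x := 0)"
| "exec w (Seq p q) \<sigma> = exec w q (exec w p \<sigma>)"
| "exec w (Cond x c p q) \<sigma> = (if sat w c x \<sigma> then exec w p \<sigma> else exec w q \<sigma>)"
| "exec w (Rep x c p) \<sigma> =
    ((\<lambda>\<sigma>. if stop w c x \<sigma> then \<sigma> else inc w x (exec w p \<sigma>)) ^^ length w) \<sigma>"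

abbreviation For :: "nat \<Rightarrow> tst \<Rightarrow> prog \<Rightarrow> prog" where
  "For x c p \<equiv> Seq (Zero x) (Rep x c p)"

fun mods :: "prog \<Rightarrow> nat set" where
  "mods Skip = {}"
| "mods (Inc x) = {x}"
| "mods (Zero x) = {x}"
| "mods (Seq p q) = mods p \<union> mods q"
| "mods (Cond x c p q) = mods p \<union> mods q"
| "mods (Rep x c p) = insert x (mods p)"

lemma exec_frame: "y \<notin> mods p \<Longrightarrow> exec w p \<sigma> y = \<sigma> y"
proof (induction p arbitrary: \<sigma>)
  case (Rep x c p)
  have "((\<lambda>\<sigma>. if stop w c x \<sigma> then \<sigma> else inc w x (exec w p \<sigma>)) ^^ n) \<sigma> y = \<sigma> y" for n
    by (induction n) (use Rep in auto)
  then show ?case by simp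
qed auto

fun wf_prog :: "nat \<Rightarrow> prog \<Rightarrow> bool" where
  "wf_prog H Skip \<longleftrightarrow> True"
| "wf_prog H (Inc x) \<longleftrightarrow> x < H"
| "wf_prog H (Zero x) \<longleftrightarrow> x < H"
| "wf_prog H (Seq p q) \<longleftrightarrow> wf_prog H p \<and> wf_prog H q"
| "wf_prog H (Cond x c p q) \<longleftrightarrow> x < H \<and> (\<forall>y. c = At y \<longrightarrow> y < H) \<and> wf_prog H p \<and> wf_prog H q"
| "wf_prog H (Rep x c p) \<longleftrightarrow> x < H \<and> (\<forall>y. c = At y \<longrightarrow> y < H) \<and> wf_prog H p \<and> x \<notin> mods p"

text \<open>The control state of a running program is the stack of programs still to be executed;
  \<open>Inl\<close> marks the two final states, chosen by comparing register \<open>acc\<close> with register 0.\<close>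

type_synonym control = "bool + prog list"

section \<open>Compiling programs into register machines\<close>

fun rd :: "nat \<Rightarrow> control \<Rightarrow> nat" where
  "rd acc (Inr []) = acc"
| "rd acc (Inr (Inc x # K)) = x"
| "rd acc (Inr (Zero x # K)) = x"
| "rd acc (Inr (Cond x c p q # K)) = x"
| "rd acc (Inr (Rep x c p # K)) = x"
| "rd acc _ = 0"

text \<open>In a loop, \<open>b = 0\<close> means that the counter has reached
  \<open>length w\<close>; with the test this gives \<open>stop\<close>. A further round ends in the
  very stack it began with, so stacks do not grow from round to round.\<close>

fun nxt :: "control \<Rightarrow> nat \<Rightarrow> nat set \<Rightarrow> action \<times> control" where
  "nxt (Inl b) _ _ = (ANop, Inl b)"
| "nxt (Inr []) _ A = (ANop, Inl (0 \<notin> A))"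
| "nxt (Inr (Skip # K)) _ _ = (ANop, Inr K)"
| "nxt (Inr (Inc x # K)) _ _ = (AInc, Inr K)"
| "nxt (Inr (Zero x # K)) _ _ = (AZero, Inr K)"
| "nxt (Inr (Seq p q # K)) _ _ = (ANop, Inr (p # q # K))"
| "nxt (Inr (Cond x c p q # K)) b A = (ANop, Inr ((if holds c b A then p else q) # K))"
| "nxt (Inr (Rep x c p # K)) b A =
    (ANop, Inr (if holds c b A \<or> b = 0 then K else p # Inc x # Rep x c p # K))"

text \<open>The stacks that can occur while \<open>p\<close> runs on top of \<open>K\<close>.
  Because loops return to the same stack there are finitely many, which makes the control
  finite.\<close>

fun conts :: "prog \<Rightarrow> prog list \<Rightarrow> prog list set" where
  "conts (Seq p q) K = {Seq p q # K} \<union> conts p (q # K) \<union> conts q K"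
| "conts (Cond x c p q) K = {Cond x c p q # K} \<union> conts p K \<union> conts q K"
| "conts (Rep x c p) K = {Rep x c p # K, Inc x # Rep x c p # K} \<union> conts p (Inc x # Rep x c p # K)"
| "conts p K = {p # K}"

lemma finite_conts: "finite (conts p K)"
  by (induction p arbitrary: K) auto

lemma head_in_conts: "p # K \<in> conts p K"
  by (cases p) auto

lemma nxt_in_conts:
  "K' \<in> conts p K \<Longrightarrow> snd (nxt (Inr K') b A) \<in> Inr ` insert K (conts p K)"
proof (induction p arbitrary: K)
  case (Seq p q)
  then show ?case using head_in_conts[of p "q # K"] head_in_conts[of q K] by fastforce
next
  case (Cond x c p q)
  then show ?case using head_in_conts[of p K] head_in_conts[of q K] by fastforce
next
  case (Rep x c p)
  then show ?case using head_in_conts[of p "Inc x # Rep x c p # K"] by fastforce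
qed auto

lemma rd_conts: "wf_prog H p \<Longrightarrow> K' \<in> conts p K \<Longrightarrow> 0 < H \<Longrightarrow> rd acc (Inr K') < H"
  by (induction p arbitrary: K) auto

locale compiled =
  fixes H acc :: nat and main :: prog
  assumes acc: "acc < H" and main: "wf_prog H main"
begin

sublocale register_machine "rd acc" nxt H "{Inl True, Inl False} \<union> Inr ` insert [] (conts main [])"
  "Inr [main]" "Inl True" "Inl False"
proof
  fix q b A assume q: "q \<in> {Inl True, Inl False} \<union> Inr ` insert [] (conts main [])"
  show "rd acc q < H" using q rd_conts[OF main] acc by auto
  show "snd (nxt q b A) \<in> {Inl True, Inl False} \<union> Inr ` insert [] (conts main [])"
    using q nxt_in_conts[of _ main "[]" b A] by fastforce
qed (use finite_conts head_in_conts[of main "[]"] in auto)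


lemma holds_iff_sat:
  "(\<forall>y. c = At y \<longrightarrow> y < H) \<Longrightarrow> holds c (cell w (\<sigma> x)) {h. h < H \<and> \<sigma> h = \<sigma> x} \<longleftrightarrow> sat w c x \<sigma>"
  by (cases c) auto

end

text \<open>A round of a loop pays for the guard, the body and the increment; the outer
  \<open>Suc\<close> is the last guard. \<open>Cond\<close> charges for both branches, which avoids
  a maximum.\<close>

fun cost :: "prog \<Rightarrow> nat \<Rightarrow> nat" where
  "cost (Seq p q) N = Suc (cost p N + cost q N)"
| "cost (Cond x c p q) N = Suc (cost p N + cost q N)"
| "cost (Rep x c p) N = Suc (N * (cost p N + 2))"
| "cost p N = 1"

text \<open>A loop raises the exponent by one, and composition crudely adds exponents, so the degree
  depends on the program alone.\<close>

lemma cost_polynomial: "\<exists>c d. \<forall>N. cost p N \<le> c * (N + 1) ^ d"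
proof -
  have sum: "\<exists>c d. \<forall>N. Suc (f N + g N) \<le> c * (N + 1) ^ d"
    if "\<exists>c d. \<forall>N. f N \<le> c * (N + 1) ^ d" "\<exists>c d. \<forall>N. g N \<le> c * (N + 1) ^ d" for f g :: "nat \<Rightarrow> nat"
  proof -
    from that obtain a b c d where fg: "f N \<le> a * (N + 1) ^ b" "g N \<le> c * (N + 1) ^ d" for N by blast
    have "Suc (f N + g N) \<le> (a + c + 1) * (N + 1) ^ (b + d)" for N
    proof -
      have "a * (N + 1) ^ b \<le> a * (N + 1) ^ (b + d)" "c * (N + 1) ^ d \<le> c * (N + 1) ^ (b + d)"
        by (simp_all add: power_increasing)
      moreover have "1 \<le> (N + 1) ^ (b + d)" by (rule one_le_power) simp
      ultimately have "Suc (f N + g N) \<le> a * (N + 1) ^ (b + d) + c * (N + 1) ^ (b + d) + (N + 1) ^ (b + d)"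
        using fg[of N] by linarith
      then show ?thesis by (simp add: algebra_simps)
    qed
    then show ?thesis by blast
  qed
  show ?thesis
  proof (induction p)
    case (Rep x t p)
    then obtain c d where cd: "cost p N \<le> c * (N + 1) ^ d" for N by blast
    have "Suc (N * (cost p N + 2)) \<le> (c + 3) * (N + 1) ^ (d + 1)" for N
    proof -
      have one: "1 \<le> (N + 1) ^ d" by (rule one_le_power) simp
      have "cost p N + 2 \<le> c * (N + 1) ^ d + 2 * (N + 1) ^ d" using cd[of N] one by linarith
      then have "cost p N + 2 \<le> (c + 2) * (N + 1) ^ d" by (simp add: algebra_simps)
      then have "N * (cost p N + 2) \<le> (N + 1) * ((c + 2) * (N + 1) ^ d)" by (intro mult_mono) auto
      moreover have "1 \<le> (N + 1) ^ (d + 1)" by (rule one_le_power) simp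
      ultimately have "Suc (N * (cost p N + 2)) \<le> (N + 1) * ((c + 2) * (N + 1) ^ d) + (N + 1) ^ (d + 1)"
        by linarith
      then show ?thesis by (simp add: algebra_simps)
    qed
    then show ?case unfolding cost.simps by blast
  next
    case (Seq p q)
    then show ?case using sum by simp
  next
    case (Cond x c p q)
    then show ?case using sum by simp
  qed (auto intro: exI[of _ 1])
qed

context compiled
begin

lemma exec_rsteps:
  assumes w: "set w \<subseteq> {1, 2, 3}"
  shows "wf_prog H p \<Longrightarrow> \<exists>t \<le> cost p (length w). (rstep w ^^ t) (Inr (p # K), \<sigma>) = (Inr K, exec w p \<sigma>)"
proof (induction p arbitrary: K \<sigma>)
  case Skip
  then show ?case by (intro exI[of _ 1]) simp
next
  case (Inc x)
  then show ?case by (intro exI[of _ 1]) simp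
next
  case (Zero x)
  then show ?case by (intro exI[of _ 1]) (simp add: fun_upd_def)
next
  case (Seq p q)
  have s: "rstep w (Inr (Seq p q # K), \<sigma>) = (Inr (p # q # K), \<sigma>)" by simp
  obtain t1 where t1: "t1 \<le> cost p (length w)"
    "(rstep w ^^ t1) (Inr (p # q # K), \<sigma>) = (Inr (q # K), exec w p \<sigma>)"
    using Seq.IH(1) Seq.prems by (metis wf_prog.simps(4))
  obtain t2 where t2: "t2 \<le> cost q (length w)"
    "(rstep w ^^ t2) (Inr (q # K), exec w p \<sigma>) = (Inr K, exec w q (exec w p \<sigma>))"
    using Seq.IH(2) Seq.prems by (metis wf_prog.simps(4))
  have "(rstep w ^^ (t2 + (t1 + 1))) (Inr (Seq p q # K), \<sigma>) = (Inr K, exec w (Seq p q) \<sigma>)"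
    unfolding funpow_add comp_apply using s t1 t2 by simp
  then show ?case using t1 t2 by (intro exI[of _ "t2 + (t1 + 1)"]) simp
next
  case (Cond x c p q)
  define r where "r = (if sat w c x \<sigma> then p else q)"
  have s: "rstep w (Inr (Cond x c p q # K), \<sigma>) = (Inr (r # K), \<sigma>)"
    using Cond.prems by (simp add: holds_iff_sat r_def)
  have "wf_prog H p" "wf_prog H q" using Cond.prems by auto
  then have "\<exists>t \<le> cost r (length w). (rstep w ^^ t) (Inr (r # K), \<sigma>) = (Inr K, exec w r \<sigma>)"
    using Cond.IH unfolding r_def by (cases "sat w c x \<sigma>") (simp_all only: if_True if_False)
  then obtain t where t: "t \<le> cost r (length w)"
    "(rstep w ^^ t) (Inr (r # K), \<sigma>) = (Inr K, exec w r \<sigma>)" by blast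
  have "(rstep w ^^ (t + 1)) (Inr (Cond x c p q # K), \<sigma>) = (Inr K, exec w (Cond x c p q) \<sigma>)"
    unfolding funpow_add comp_apply using s t by (simp add: r_def)
  moreover have "t + 1 \<le> cost (Cond x c p q) (length w)" using t(1) by (auto simp: r_def split: if_splits)
  ultimately show ?case by blast
next
  case (Rep x c p)
  let ?F = "\<lambda>\<sigma>. if stop w c x \<sigma> then \<sigma> else inc w x (exec w p \<sigma>)"
  let ?R = "Rep x c p # K"
  have okp: "wf_prog H p" "x \<notin> mods p" "x < H" and c: "\<forall>y. c = At y \<longrightarrow> y < H" using Rep.prems by auto
  have guard: "rstep w (Inr ?R, \<sigma>) = (Inr (if stop w c x \<sigma> then K else p # Inc x # ?R), \<sigma>)" for \<sigma>
    using holds_iff_sat[OF c, of w \<sigma> x] cell_nonzero[OF w, of "\<sigma> x"] by (auto simp: stop_def)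
  \<comment> \<open>Generalised from \<open>length w\<close> iterations to any \<open>n\<close> that
    is at least the number of rounds left: surplus iterations of \<open>?F\<close> are idle, while
    the machine leaves the loop at the first \<open>stop\<close>.\<close>
  have "\<exists>t \<le> Suc (n * (cost p (length w) + 2)). (rstep w ^^ t) (Inr ?R, \<sigma>) = (Inr K, (?F ^^ n) \<sigma>)"
    if "length w - \<sigma> x \<le> n" for n \<sigma>
    using that
  proof (induction n arbitrary: \<sigma>)
    case 0
    then have "stop w c x \<sigma>" by (simp add: stop_def)
    then show ?case using guard[of \<sigma>] by (intro exI[of _ 1]) (simp del: rstep.simps)
  next
    case (Suc n)
    show ?case
    proof (cases "stop w c x \<sigma>")
      case True
      have "(?F ^^ Suc n) \<sigma> = \<sigma>" by (induction n) (use True in auto)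
      then show ?thesis using guard[of \<sigma>] True
        by (intro exI[of _ 1]) (simp del: rstep.simps funpow.simps(2) add: funpow.simps(2)[of 0])
    next
      case False
      obtain t1 where t1: "t1 \<le> cost p (length w)"
        "(rstep w ^^ t1) (Inr (p # Inc x # ?R), \<sigma>) = (Inr (Inc x # ?R), exec w p \<sigma>)"
        using Rep.IH[OF okp(1)] by blast
      have F: "?F \<sigma> = inc w x (exec w p \<sigma>)" using False by simp
      have fr: "exec w p \<sigma> x = \<sigma> x" using okp by (simp add: exec_frame)
      have "\<sigma> x < length w" using False by (simp add: stop_def)
      then have "length w - ?F \<sigma> x \<le> n" using F fr Suc.prems by simp
      from Suc.IH[of "?F \<sigma>", OF this] obtain t2 where t2: "t2 \<le> Suc (n * (cost p (length w) + 2))"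
        "(rstep w ^^ t2) (Inr ?R, ?F \<sigma>) = (Inr K, (?F ^^ n) (?F \<sigma>))" by blast
      have "rstep w (Inr (Inc x # ?R), exec w p \<sigma>) = (Inr ?R, ?F \<sigma>)" using F by simp
      then have "(rstep w ^^ (t2 + (1 + (t1 + 1)))) (Inr ?R, \<sigma>) = (Inr K, (?F ^^ n) (?F \<sigma>))"
        unfolding funpow_add comp_apply using t1(2) t2(2) guard[of \<sigma>] False
        by (simp del: rstep.simps)
      also have "(?F ^^ n) (?F \<sigma>) = (?F ^^ Suc n) \<sigma>" by (simp only: funpow_Suc_right comp_apply)
      finally show ?thesis using t1(1) t2(1) by (intro exI[of _ "t2 + (1 + (t1 + 1))"]) (simp del: funpow.simps)
    qed
  qed
  from this[of \<sigma> "length w"] show ?case by simp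
qed

theorem polynomial_time_tm_of_program:
  "\<exists>M c d. wf_tm M \<and> (\<forall>w. set w \<subseteq> {1, 2, 3} \<longrightarrow>
     (let cfg = run M (c * (length w + 1) ^ d) w in halted M cfg \<and>
      (accepted M cfg \<longleftrightarrow> exec w main (\<lambda>_. 0) acc \<noteq> exec w main (\<lambda>_. 0) 0)))"
proof -
  obtain M where M: "wf_tm M" "\<And>w t T \<sigma> b. set w \<subseteq> {1, 2, 3} \<Longrightarrow>
      (rstep w ^^ t) (Inr [main], \<lambda>_. 0) = ((if b then Inl True else Inl False), \<sigma>) \<Longrightarrow>
      t * (2 * length w + 6) + 1 \<le> T \<Longrightarrow>
      halted M (run M T w) \<and> (accepted M (run M T w) \<longleftrightarrow> b)"
    using tm_of_register_machine by metis
  obtain c d where cd: "cost main N \<le> c * (N + 1) ^ d" for N using cost_polynomial by blast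
  \<comment> \<open>With \<open>N = length w\<close>, one step for the final comparison gives
    \<open>Suc t \<le> (c + 1) * (N + 1) ^ d\<close>, and
    \<open>2 * N + 6 \<le> 6 * (N + 1)\<close>. Adding the start step yields the factor
    \<open>6 * (c + 1) + 1 = 6 * c + 7\<close>.\<close>
  have "halted M (run M ((6 * c + 7) * (length w + 1) ^ (d + 1)) w) \<and>
     (accepted M (run M ((6 * c + 7) * (length w + 1) ^ (d + 1)) w) \<longleftrightarrow>
        exec w main (\<lambda>_. 0) acc \<noteq> exec w main (\<lambda>_. 0) 0)" if w: "set w \<subseteq> {1, 2, 3}" for w
  proof (rule M(2)[OF w])
    let ?\<sigma> = "exec w main (\<lambda>_. 0)"
    define t where "t = (SOME t. t \<le> cost main (length w) \<and>
      (rstep w ^^ t) (Inr [main], \<lambda>_. 0) = (Inr [], ?\<sigma>))"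
    have t: "t \<le> cost main (length w)" "(rstep w ^^ t) (Inr [main], \<lambda>_. 0) = (Inr [], ?\<sigma>)"
      using someI_ex[OF exec_rsteps[OF w main, of "[]" "\<lambda>_. 0"]] unfolding t_def by auto
    have "rstep w (Inr [], ?\<sigma>) = ((if ?\<sigma> acc \<noteq> ?\<sigma> 0 then Inl True else Inl False), ?\<sigma>)"
      using acc by auto
    then show "(rstep w ^^ Suc t) (Inr [main], \<lambda>_. 0) =
        ((if ?\<sigma> acc \<noteq> ?\<sigma> 0 then Inl True else Inl False), ?\<sigma>)"
      using t(2) by (simp del: rstep.simps)
    let ?N = "length w"
    have "1 \<le> (?N + 1) ^ d" by (rule one_le_power) simp
    then have "Suc t \<le> c * (?N + 1) ^ d + (?N + 1) ^ d" using t(1) cd[of ?N] by linarith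
    then have "Suc t \<le> (c + 1) * (?N + 1) ^ d" by simp
    then have "Suc t * (2 * ?N + 6) \<le> ((c + 1) * (?N + 1) ^ d) * (6 * (?N + 1))"
      by (intro mult_mono) auto
    moreover have "1 \<le> (?N + 1) ^ (d + 1)" by (rule one_le_power) simp
    ultimately have "Suc t * (2 * ?N + 6) + 1 \<le> ((c + 1) * (?N + 1) ^ d) * (6 * (?N + 1)) + (?N + 1) ^ (d + 1)"
      by linarith
    then show "Suc t * (2 * ?N + 6) + 1 \<le> (6 * c + 7) * (?N + 1) ^ (d + 1)"
      by (simp add: algebra_simps)
  qed
  with M(1) show ?thesis unfolding Let_def by blast
qed

end

text \<open>\<open>s i\<close> is the state before round \<open>i\<close>, except that the counter
  \<open>x\<close> may be stale in it; each round overwrites it. \<open>m\<close> is the first value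
  at which the test succeeds, or the end of the word.\<close>

lemma exec_For:
  assumes x: "x \<notin> mods p" and m: "m \<le> length w"
    and s: "\<And>i. s i = fold (\<lambda>i \<sigma>. exec w p (\<sigma>(x := i))) [0..<i] \<sigma>"
    and go: "\<And>i. i < m \<Longrightarrow> \<not> sat w c x ((s i)(x := i))"
    and st: "m = length w \<or> sat w c x ((s m)(x := m))"
  shows "exec w (For x c p) \<sigma> = (s m)(x := m)"
proof -
  let ?F = "\<lambda>\<sigma>. if stop w c x \<sigma> then \<sigma> else inc w x (exec w p \<sigma>)"
  have it: "(?F ^^ i) (\<sigma>(x := 0)) = (s i)(x := i)" if "i \<le> m" for i
    using that
  proof (induction i)
    case 0
    then show ?case by (simp add: s)
  next
    case (Suc i)
    have "\<not> stop w c x ((s i)(x := i))" using go[of i] Suc.prems m by (simp add: stop_def)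
    moreover have e: "exec w p ((s i)(x := i)) = s (Suc i)" by (simp add: s)
    moreover have "s (Suc i) x = i" unfolding e[symmetric] using exec_frame[OF x] by simp
    ultimately have "?F ((s i)(x := i)) = (s (Suc i))(x := Suc i)" using Suc.prems m by simp
    moreover have "(?F ^^ i) (\<sigma>(x := 0)) = (s i)(x := i)" by (rule Suc.IH) (use Suc.prems in simp)
    ultimately show ?case by (simp only: funpow.simps(2) comp_apply)
  qed
  have "stop w c x ((s m)(x := m))" using st by (auto simp: stop_def)
  then have "(?F ^^ n) ((s m)(x := m)) = (s m)(x := m)" for n by (induction n) auto
  then have "(?F ^^ ((length w - m) + m)) (\<sigma>(x := 0)) = (s m)(x := m)"
    unfolding funpow_add comp_apply it[OF order_refl] .
  then show ?thesis using m by simp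
qed

lemma exec_For_upto:
  assumes "x \<notin> mods p" "y \<notin> mods p" "x \<noteq> y" "\<sigma> y \<le> length w"
  shows "exec w (For x (At y) p) \<sigma> = (fold (\<lambda>i \<sigma>. exec w p (\<sigma>(x := i))) [0..<\<sigma> y] \<sigma>)(x := \<sigma> y)"
proof (rule exec_For[OF assms(1,4) refl])
  have "fold (\<lambda>i \<sigma>. exec w p (\<sigma>(x := i))) [0..<i] \<sigma> y = \<sigma> y" for i
    by (induction i) (use assms exec_frame in auto)
  note fr = this
  show "\<not> sat w (At y) x ((fold (\<lambda>i \<sigma>. exec w p (\<sigma>(x := i))) [0..<i] \<sigma>)(x := i))" if "i < \<sigma> y" for i
    using that assms(3) fr by auto
  show "\<sigma> y = length w \<or> sat w (At y) x ((fold (\<lambda>i \<sigma>. exec w p (\<sigma>(x := i))) [0..<\<sigma> y] \<sigma>)(x := \<sigma> y))"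
    using assms(3) fr by auto
qed

text \<open>The symbol 0 does not occur in the word, so the test cannot fire before the blank behind
  it.\<close>

lemma exec_For_all:
  assumes "x \<notin> mods p" "set w \<subseteq> {1, 2, 3}"
  shows "exec w (For x (Cell 0) p) \<sigma> =
    (fold (\<lambda>i \<sigma>. exec w p (\<sigma>(x := i))) [0..<length w] \<sigma>)(x := length w)"
proof (rule exec_For[OF assms(1) order_refl refl])
  have "w ! i \<in> {1, 2, 3}" if "i < length w" for i using assms(2) that nth_mem by blast
  then show "\<not> sat w (Cell 0) x ((fold (\<lambda>i \<sigma>. exec w p (\<sigma>(x := i))) [0..<i] \<sigma>)(x := i))"
    if "i < length w" for i using that by (force simp: cell_def nth0_def)
qed simp

section \<open>The search program\<close>

lemma nth_concat_rows:
  "u < r \<Longrightarrow> v < n \<Longrightarrow> (concat (map (\<lambda>u. map (g u) [0..<n]) [0..<r]) @ ys) ! (u * n + v) = g u v"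
proof (induction r arbitrary: ys)
  case (Suc r)
  have len: "length (concat (map (\<lambda>u. map (g u) [0..<n]) [0..<r])) = r * n"
    by (simp add: length_concat comp_def sum_list_triv)
  show ?case
  proof (cases "u = r")
    case True
    then show ?thesis using Suc.prems len by (simp add: nth_append)
  next
    case False
    then show ?thesis using Suc by simp
  qed
qed simp

lemma set_encode_word: "set (encode n E col) \<subseteq> {1, 2, 3}"
  by (auto simp: encode_def bit_sym_def)

lemma encode_nth:
  "u < n \<Longrightarrow> v < n \<Longrightarrow> encode n E col ! (u * n + v) = bit_sym (E u v)"
  unfolding encode_def using nth_concat_rows[of u n v n "\<lambda>u v. bit_sym (E u v)"] by simp

text \<open>One separator closes the matrix and one closes each vertex; counting separators is how
  the program finds \<open>n\<close>.\<close>

lemma count_encode: "count_list (encode n E col) 3 = Suc n"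
proof -
  have rep: "count_list (replicate j (2::nat)) 3 = 0" for j by (induction j) auto
  have "count_list (concat (map (\<lambda>v. replicate (col v) 2 @ [3::nat]) [0..<m])) 3 = m" for m
    by (induction m) (auto simp: rep)
  moreover have "3 \<notin> set (concat (map (\<lambda>u. map (\<lambda>v. bit_sym (E u v)) [0..<n]) [0..<n]))"
    by (auto simp: bit_sym_def)
  ultimately show ?thesis by (simp add: encode_def count_notin)
qed

text \<open>Whatever the program stores must not exceed \<open>length w\<close>: the number
  \<open>n + 1\<close>, the colours (thanks to the unary code) and the matrix addresses.\<close>

lemma encode_length_bounds:
  shows "Suc n \<le> length (encode n E col)"
    and "v < n \<Longrightarrow> col v < length (encode n E col)"
    and "u < n \<Longrightarrow> v < n \<Longrightarrow> u * n + v < length (encode n E col)"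
proof -
  show "Suc n \<le> length (encode n E col)"
    using count_le_length[of "encode n E col" 3] by (simp add: count_encode)
  let ?B = "\<lambda>v. replicate (col v) 2 @ [3::nat]"
  show "col v < length (encode n E col)" if "v < n"
  proof -
    have "length (?B v) \<le> sum_list (map length (map ?B [0..<n]))"
      using that by (intro member_le_sum_list) auto
    then show ?thesis by (simp add: encode_def length_concat)
  qed
  show "u * n + v < length (encode n E col)" if "u < n" "v < n"
  proof -
    have "u * n + v < u * n + n" using that by simp
    also have "\<dots> = Suc u * n" by simp
    also have "\<dots> \<le> n * n" using that by (intro mult_le_mono1) simp
    also have "\<dots> \<le> length (encode n E col)"
      by (simp add: encode_def length_concat comp_def sum_list_triv)
    finally show ?thesis .
  qed
qed

text \<open>Register 0 is never written, so \<open>At 0\<close> tests for zero. Register \<open>reg h\<close>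
  holds the entry \<open>h\<close> of a choice, and \<open>nn\<close>, \<open>n1\<close> hold \<open>n\<close> and \<open>n + 1\<close>.\<close>

abbreviation (input) "nn \<equiv> 2::nat"
abbreviation (input) "n1 \<equiv> 3::nat"
abbreviation (input) "ri \<equiv> 4::nat"
abbreviation (input) "rj \<equiv> 5::nat"
abbreviation (input) "rp \<equiv> 6::nat"
abbreviation (input) "bad \<equiv> 7::nat"
abbreviation (input) "acc \<equiv> 8::nat"
abbreviation (input) "ac \<equiv> 9::nat"
abbreviation (input) "c1 \<equiv> 10::nat"
abbreviation (input) "c2 \<equiv> 11::nat"
abbreviation (input) "seen \<equiv> 12::nat"
abbreviation (input) "cc \<equiv> 13::nat"
abbreviation (input) "rv \<equiv> 14::nat"
abbreviation (input) "fl \<equiv> 15::nat"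
abbreviation (input) "reg h \<equiv> 16 + h :: nat"

section \<open>Programs for the tests and the search\<close>

fun seqs :: "prog list \<Rightarrow> prog" where
  "seqs [] = Skip"
| "seqs (p # ps) = Seq p (seqs ps)"

lemma mods_seqs [simp]: "mods (seqs ps) = (\<Union>p\<in>set ps. mods p)"
  by (induction ps) auto

lemma wf_prog_seqs [simp]: "wf_prog H (seqs ps) \<longleftrightarrow> (\<forall>p\<in>set ps. wf_prog H p)"
  by (induction ps) auto

definition addr :: "nat \<Rightarrow> nat \<Rightarrow> prog" where
  "addr u v = Seq (Zero rp) (Seq (For ri (At u) (For rj (At nn) (Inc rp))) (For ri (At v) (Inc rp)))"

lemma mods_addr [simp]: "mods (addr u v) = {rp, ri, rj}"
  by (auto simp: addr_def)

lemma exec_add: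
  assumes "j \<noteq> y" "j \<noteq> rp" "y \<noteq> rp" "\<sigma> rp + \<sigma> y \<le> length w"
  shows "exec w (For j (At y) (Inc rp)) \<sigma> rp = \<sigma> rp + \<sigma> y"
proof -
  have "fold (\<lambda>i \<sigma>. exec w (Inc rp) (\<sigma>(j := i))) [0..<i] \<sigma> rp = \<sigma> rp + i" if "i \<le> \<sigma> y" for i
    using that by (induction i) (use assms in auto)
  then show ?thesis using assms by (subst exec_For_upto) auto
qed

text \<open>The size hypotheses keep every partial sum within \<open>length w\<close>, where
  increments are exact rather than saturating.\<close>

lemma exec_addr:
  assumes uv: "u \<notin> {ri, rj, rp}" "v \<notin> {ri, rj, rp}"
    and le: "\<sigma> u * \<sigma> nn + \<sigma> v \<le> length w" "\<sigma> u \<le> length w"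
  shows "exec w (addr u v) \<sigma> rp = \<sigma> u * \<sigma> nn + \<sigma> v"
proof -
  define p where "p = For rj (At nn) (Inc rp)"
  have p: "mods p = {rj, rp}" by (auto simp: p_def)
  define S where "S i = fold (\<lambda>i \<sigma>. exec w p (\<sigma>(ri := i))) [0..<i] (\<sigma>(rp := 0))" for i
  have S: "S 0 = \<sigma>(rp := 0)" "S (Suc i) = exec w p ((S i)(ri := i))" for i
    by (simp_all add: S_def)
  have fr: "S i y = \<sigma> y" if "y \<notin> {ri, rj, rp}" for i y
    by (induction i) (use that exec_frame[of y p w] in \<open>auto simp: S p\<close>)
  have s: "S i rp = i * \<sigma> nn" if "i \<le> \<sigma> u" for i
    using that
  proof (induction i)
    case (Suc i)
    have "Suc i * \<sigma> nn \<le> \<sigma> u * \<sigma> nn" using Suc.prems by (intro mult_le_mono1)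
    then have "i * \<sigma> nn + \<sigma> nn \<le> length w" using le by simp
    moreover have "S i rp = i * \<sigma> nn" "S i nn = \<sigma> nn" using Suc fr[of nn i] by auto
    ultimately have "exec w p ((S i)(ri := i)) rp = i * \<sigma> nn + \<sigma> nn"
      unfolding p_def by (subst exec_add) auto
    then show ?case by (simp add: S)
  qed (simp add: S)
  let ?t = "exec w (For ri (At u) p) (\<sigma>(rp := 0))"
  have "?t = (S (\<sigma> u))(ri := \<sigma> u)"
    using uv le(2) exec_For_upto[of ri p u "\<sigma>(rp := 0)" w] by (simp add: S_def p)
  then have "?t rp = \<sigma> u * \<sigma> nn" "?t v = \<sigma> v" using s[OF order_refl] fr[of v "\<sigma> u"] uv by auto
  then have "exec w (For ri (At v) (Inc rp)) ?t rp = \<sigma> u * \<sigma> nn + \<sigma> v"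
    using exec_add[of ri v ?t w] uv le by simp
  then show ?thesis by (simp add: addr_def p_def)
qed

text \<open>Failures only raise \<open>bad\<close>, which is compared with 0 alone, so saturation
  does no harm. The matrix is consulted only if both entries are vertices, since \<open>n\<close>
  has no row.\<close>

definition pair_prog :: "nat \<Rightarrow> nat \<Rightarrow> prog" where
  "pair_prog h g =
    (if h div 3 = g div 3 then
       Cond (reg h) (At nn) (Cond (reg g) (At nn) Skip (Inc bad))
         (Cond (reg g) (At nn) (Inc bad)
            (Seq (addr (reg h) (reg g)) (Cond rp (Cell 2) Skip (Inc bad))))
     else Cond (reg h) (At nn) Skip (Cond (reg h) (At (reg g)) (Inc bad) Skip))"

definition pairs_prog :: "nat \<Rightarrow> prog" where
  "pairs_prog m = seqs (map (\<lambda>(h, g). pair_prog h g)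
     (filter (\<lambda>(h, g). h \<noteq> g) (List.product [0..<m] [0..<m])))"

text \<open>A counter modulo 3: the residues 0, 1, 2 are coded by \<open>(c1, c2)\<close> as (0, 0),
  (1, 0), (1, 1).\<close>

definition count_mod3 :: prog where
  "count_mod3 = Cond c1 (At 0) (Inc c1) (Cond c2 (At 0) (Inc c2) (Seq (Zero c1) (Zero c2)))"

definition chosen_prog :: "nat \<Rightarrow> prog" where
  "chosen_prog m = Seq (Zero fl) (seqs (map (\<lambda>h. Cond rv (At (reg h)) (Inc fl) Skip) [0..<m]))"

text \<open>Nothing is counted before the first separator; afterwards \<open>cc\<close> counts the
  unary digits of the current block, and a separator completes vertex \<open>rv\<close>.\<close>

definition scan_prog :: "nat \<Rightarrow> prog" where
  "scan_prog m =
    Cond rp (Cell 3)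
      (Cond seen (At 0) (Inc seen)
         (Seq (Cond cc (At ac) (Seq (chosen_prog m) (Cond fl (At 0) count_mod3 Skip)) Skip)
              (Seq (Inc rv) (Zero cc))))
      (Cond seen (At 0) Skip (Inc cc))"

definition class_prog :: "nat \<Rightarrow> prog" where
  "class_prog m = Seq (Zero c1) (Seq (Zero c2) (Seq (Zero seen) (Seq (Zero cc) (Seq (Zero rv)
     (Seq (For rp (Cell 0) (scan_prog m)) (Cond c1 (At 0) Skip (Inc bad)))))))"

text \<open>The loop tries every value of \<open>ac\<close> below the length of the word. Values
  that no vertex has as its colour give an empty class and pass, so \<open>k\<close> enters only
  through \<open>m\<close>.\<close>

definition check_prog :: "nat \<Rightarrow> prog" where
  "check_prog m = Seq (Zero bad) (Seq (pairs_prog m)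
     (Seq (For ac (Cell 0) (class_prog m)) (Cond bad (At 0) (Inc acc) Skip)))"

text \<open>The loop bound is \<open>n1\<close> because the value \<open>n\<close> of an empty entry
  must be tried too. \<open>acc\<close> is never reset, so started at 0 it ends nonzero iff some
  choice passed.\<close>

fun search_prog :: "nat \<Rightarrow> nat \<Rightarrow> prog" where
  "search_prog m 0 = check_prog m"
| "search_prog m (Suc j) = For (reg j) (At n1) (search_prog m j)"

text \<open>At the first separator \<open>n1\<close> is still 0, so \<open>nn\<close> skips the one
  that closes the matrix and ends one behind \<open>n1\<close>.\<close>

definition init_prog :: prog where
  "init_prog = For ri (Cell 0) (Cond ri (Cell 3) (Seq (Cond n1 (At 0) Skip (Inc nn)) (Inc n1)) Skip)"

definition main_prog :: "nat \<Rightarrow> prog" where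
  "main_prog m = Seq init_prog (search_prog m m)"

section \<open>Registers written, and well-formedness\<close>

lemma mods_pair: "mods (pair_prog h g) \<subseteq> {rp, ri, rj, bad}"
  by (auto simp: pair_prog_def)

lemma mods_pairs: "mods (pairs_prog m) \<subseteq> {rp, ri, rj, bad}"
  using mods_pair by (fastforce simp: pairs_prog_def)

lemma mods_chosen [simp]: "mods (chosen_prog m) = {fl}"
  by (auto simp: chosen_prog_def)

lemma mods_scan [simp]: "mods (scan_prog m) = {fl, c1, c2, rv, cc, seen}"
  by (auto simp: scan_prog_def count_mod3_def)

lemma mods_class [simp]: "mods (class_prog m) = {fl, c1, c2, rv, cc, seen, rp, bad}"
  by (auto simp: class_prog_def)

lemma mods_check: "mods (check_prog m) \<subseteq> {ri..fl}"
  using mods_pairs[of m] by (auto simp: check_prog_def)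

text \<open>The search below \<open>j\<close> writes neither \<open>reg j\<close> nor any later
  entry, as the enclosing loop requires, and spares registers 0, \<open>nn\<close> and
  \<open>n1\<close>.\<close>

lemma mods_search: "mods (search_prog m j) \<subseteq> {ri..<reg j}"
  by (induction j) (use mods_check[of m] in \<open>auto simp: subset_iff\<close>)

lemma wf_prog_main: "wf_prog (reg m) (main_prog m)"
proof -
  have pr: "wf_prog (reg m) (pair_prog h g)" if "h < m" "g < m" for h g
    using that by (auto simp: pair_prog_def addr_def)
  have "wf_prog (reg m) (check_prog m)"
    using pr by (auto simp: check_prog_def class_prog_def scan_prog_def count_mod3_def
      chosen_prog_def pairs_prog_def)
  then have "j \<le> m \<Longrightarrow> wf_prog (reg m) (search_prog m j)" for j
    by (induction j) (use mods_search in \<open>auto simp: subset_iff\<close>)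
  then show ?thesis by (auto simp: main_prog_def init_prog_def)
qed

section \<open>Correctness of the tests\<close>

text \<open>On a nonempty word, incrementing a zero flag is visible; a nonzero flag stays nonzero
  even when saturated.\<close>

lemma exec_pair:
  assumes w: "w \<noteq> []" and n: "\<sigma> nn = n" "n \<le> length w" and le: "\<sigma> (reg h) \<le> n" "\<sigma> (reg g) \<le> n"
    and mat: "\<And>u v. u < n \<Longrightarrow> v < n \<Longrightarrow> u * n + v < length w \<and> (cell w (u * n + v) = 2 \<longleftrightarrow> E u v)"
  shows "exec w (pair_prog h g) \<sigma> bad = 0 \<longleftrightarrow>
    \<sigma> bad = 0 \<and> pair_ok n E (h div 3 = g div 3) (\<sigma> (reg h)) (\<sigma> (reg g))"
proof (cases "h div 3 = g div 3 \<and> \<sigma> (reg h) < n \<and> \<sigma> (reg g) < n")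
  case True
  let ?a = "addr (reg h) (reg g)"
  have "exec w ?a \<sigma> rp = \<sigma> (reg h) * \<sigma> nn + \<sigma> (reg g)"
    using mat[of "\<sigma> (reg h)" "\<sigma> (reg g)"] True n by (intro exec_addr) auto
  moreover have "exec w ?a \<sigma> bad = \<sigma> bad" by (rule exec_frame) simp
  ultimately show ?thesis
    using True n w mat[of "\<sigma> (reg h)" "\<sigma> (reg g)"] by (auto simp: pair_prog_def pair_ok_def)
next
  case False
  then show ?thesis using n le w by (auto simp: pair_prog_def pair_ok_def)
qed

lemma exec_pairs:
  assumes w: "w \<noteq> []" and n: "\<sigma> nn = n" "n \<le> length w" and le: "\<And>h. h < m \<Longrightarrow> \<sigma> (reg h) \<le> n"
    and mat: "\<And>u v. u < n \<Longrightarrow> v < n \<Longrightarrow> u * n + v < length w \<and> (cell w (u * n + v) = 2 \<longleftrightarrow> E u v)"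
  shows "exec w (pairs_prog m) \<sigma> bad = 0 \<longleftrightarrow> \<sigma> bad = 0 \<and>
    (\<forall>h<m. \<forall>g<m. h \<noteq> g \<longrightarrow> pair_ok n E (h div 3 = g div 3) (\<sigma> (reg h)) (\<sigma> (reg g)))"
proof -
  let ?l = "filter (\<lambda>(h, g). h \<noteq> g) (List.product [0..<m] [0..<m])"
  let ?ok = "\<lambda>h g. pair_ok n E (h div 3 = g div 3) (\<sigma> (reg h)) (\<sigma> (reg g))"
  \<comment> \<open>Generalised over the start state: earlier pairs have changed the scratch
    registers and \<open>bad\<close>, while the entries and \<open>nn\<close> keep their values from
    \<open>\<sigma>\<close>.\<close>
  have "exec w (seqs (map (\<lambda>(h, g). pair_prog h g) l)) \<tau> bad = 0 \<longleftrightarrow>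
      \<tau> bad = 0 \<and> (\<forall>(h, g)\<in>set l. ?ok h g)"
    if "\<forall>(h, g)\<in>set l. h < m \<and> g < m" "\<And>y. y \<notin> {rp, ri, rj, bad} \<Longrightarrow> \<tau> y = \<sigma> y" for l \<tau>
    using that
  proof (induction l arbitrary: \<tau>)
    case (Cons x l)
    obtain h g where x: "x = (h, g)" by (cases x)
    have hg: "h < m" "g < m" using Cons.prems x by auto
    let ?t = "exec w (pair_prog h g) \<tau>"
    have \<tau>: "\<tau> nn = n" "\<tau> (reg h) = \<sigma> (reg h)" "\<tau> (reg g) = \<sigma> (reg g)"
      using Cons.prems(2) n by auto
    have "?t bad = 0 \<longleftrightarrow> \<tau> bad = 0 \<and> ?ok h g"
      using exec_pair[of w \<tau> n h g E] \<tau> le hg n w mat by simp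
    moreover have "?t y = \<sigma> y" if "y \<notin> {rp, ri, rj, bad}" for y
      using exec_frame[of y "pair_prog h g" w \<tau>] mods_pair[of h g] that Cons.prems(2) by auto
    ultimately show ?case using Cons.IH[of ?t] Cons.prems x by auto
  qed simp
  from this[of ?l \<sigma>] show ?thesis unfolding pairs_prog_def by auto
qed

lemma exec_chosen:
  assumes "w \<noteq> []"
  shows "exec w (chosen_prog m) \<sigma> fl = 0 \<longleftrightarrow> \<sigma> rv \<notin> (\<lambda>h. \<sigma> (reg h)) ` {..<m}"
proof -
  have "exec w (seqs (map (\<lambda>h. Cond rv (At (reg h)) (Inc fl) Skip) l)) \<tau> fl = 0 \<longleftrightarrow>
      \<tau> fl = 0 \<and> (\<forall>h\<in>set l. \<sigma> rv \<noteq> \<sigma> (reg h))"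
    if "\<And>y. y \<noteq> fl \<Longrightarrow> \<tau> y = \<sigma> y" for l \<tau>
    using that
  proof (induction l arbitrary: \<tau>)
    case (Cons h l)
    let ?t = "exec w (Cond rv (At (reg h)) (Inc fl) Skip) \<tau>"
    have "?t fl = 0 \<longleftrightarrow> \<tau> fl = 0 \<and> \<sigma> rv \<noteq> \<sigma> (reg h)" using Cons.prems assms by (cases "\<tau> fl") auto
    moreover have "?t y = \<sigma> y" if "y \<noteq> fl" for y using Cons.prems that by auto
    ultimately show ?case using Cons.IH[of ?t] by auto
  qed simp
  from this[of "\<sigma>(fl := 0)" "[0..<m]"] show ?thesis by (auto simp: chosen_prog_def)
qed
lemma exec_count_mod3:
  assumes "w \<noteq> []" "\<sigma> 0 = 0" "\<sigma> c1 = (if c mod 3 = 0 then 0 else 1)" "\<sigma> c2 = (if c mod 3 = 2 then 1 else 0)"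
  shows "exec w count_mod3 \<sigma> c1 = (if Suc c mod 3 = 0 then 0 else 1) \<and>
    exec w count_mod3 \<sigma> c2 = (if Suc c mod 3 = 2 then 1 else 0)"
proof -
  have "c mod 3 = 0 \<or> c mod 3 = 1 \<or> c mod 3 = 2" by arith
  then show ?thesis using assms by (elim disjE) (auto simp: count_mod3_def mod_Suc)
qed

text \<open>The scan state records whether the separator behind the adjacency matrix has been
  passed, the colour digits read in the current block, the number of completed blocks, and
  the number of vertices of colour \<open>a\<close> outside \<open>F\<close> seen so far.\<close>

fun scan_step :: "nat \<Rightarrow> nat set \<Rightarrow> nat \<Rightarrow> bool \<times> nat \<times> nat \<times> nat \<Rightarrow> bool \<times> nat \<times> nat \<times> nat" where
  "scan_step a F s (b, q, v, c) =
     (if s = 3 then if b then (True, 0, Suc v, if q = a \<and> v \<notin> F then Suc c else c) else (True, q, v, c)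
      else (b, if b then Suc q else q, v, c))"

text \<open>The matrix contains no separator, so nothing has been counted when its closing separator
  is reached; after that each block settles one vertex.\<close>

lemma scan_encode:
  "fold (scan_step a F) (encode n E col) (False, 0, 0, 0) =
     (True, 0, n, card {v. v < n \<and> col v = a \<and> v \<notin> F})"
proof -
  have matrix: "fold (scan_step a F) xs (False, 0, 0, 0) = (False, 0, 0, 0)" if "3 \<notin> set xs" for xs
    using that by (induction xs) auto
  have rep: "(scan_step a F 2 ^^ j) (True, q, v, c) = (True, q + j, v, c)" for j q v c
    by (induction j) auto
  have "fold (scan_step a F) (concat (map (\<lambda>v. replicate (col v) 2 @ [3]) [0..<m])) (True, 0, 0, 0) =
     (True, 0, m, card {v. v < m \<and> col v = a \<and> v \<notin> F})" for m
  proof (induction m)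
    case (Suc m)
    have "{v. v < Suc m \<and> col v = a \<and> v \<notin> F} =
      (if col m = a \<and> m \<notin> F then insert m {v. v < m \<and> col v = a \<and> v \<notin> F}
       else {v. v < m \<and> col v = a \<and> v \<notin> F})"
      by (auto simp: less_Suc_eq)
    with Suc show ?case by (simp add: rep)
  qed simp
  moreover have "3 \<notin> set (concat (map (\<lambda>u. map (\<lambda>v. bit_sym (E u v)) [0..<n]) [0..<n]))"
    by (auto simp: bit_sym_def)
  ultimately show ?thesis unfolding encode_def by (simp add: matrix)
qed

text \<open>The bounds \<open>q \<le> i\<close> and \<open>v \<le> i\<close> make the increments of
  \<open>cc\<close> and \<open>rv\<close> at position \<open>i\<close> exact. Of the count
  \<open>c\<close> only the residue is kept, in the code of \<open>count_mod3\<close>.\<close>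

definition tracks :: "(nat \<Rightarrow> nat) \<Rightarrow> nat \<Rightarrow> bool \<times> nat \<times> nat \<times> nat \<Rightarrow> bool" where
  "tracks \<sigma> i x \<longleftrightarrow> (case x of (b, q, v, c) \<Rightarrow> (\<sigma> seen \<noteq> 0 \<longleftrightarrow> b) \<and> \<sigma> cc = q \<and> \<sigma> rv = v \<and>
     \<sigma> c1 = (if c mod 3 = 0 then 0 else 1) \<and> \<sigma> c2 = (if c mod 3 = 2 then 1 else 0) \<and> q \<le> i \<and> v \<le> i)"

lemma exec_scan:
  assumes i: "i < length w" "\<sigma> rp = i" and z: "\<sigma> 0 = 0"
    and F: "F = (\<lambda>h. \<sigma> (reg h)) ` {..<m}" and a: "a = \<sigma> ac" and tr: "tracks \<sigma> i x"
  shows "tracks (exec w (scan_prog m) \<sigma>) (Suc i) (scan_step a F (cell w i) x)"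
proof -
  obtain b q v c where x: "x = (b, q, v, c)" by (cases x) auto
  have t: "(\<sigma> seen \<noteq> 0) = b" "\<sigma> cc = q" "\<sigma> rv = v" "q \<le> i" "v \<le> i"
    and c: "\<sigma> c1 = (if c mod 3 = 0 then 0 else 1)" "\<sigma> c2 = (if c mod 3 = 2 then 1 else 0)"
    using tr unfolding tracks_def x by (auto split: prod.splits)
  have w: "w \<noteq> []" using i by auto
  show ?thesis
  proof (cases "cell w i = 3 \<and> b")
    case False
    then show ?thesis using t c i z w unfolding x by (auto simp: scan_prog_def tracks_def)
  next
    case True
    define P where "P = Cond cc (At ac) (Seq (chosen_prog m) (Cond fl (At 0) count_mod3 Skip)) Skip"
    let ?c = "if q = a \<and> v \<notin> F then Suc c else c"
    let ?t = "exec w P \<sigma>"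
    have fr: "?t y = \<sigma> y" if "y \<notin> {fl, c1, c2}" for y
      by (rule exec_frame) (use that in \<open>auto simp: P_def count_mod3_def\<close>)
    have "?t c1 = (if ?c mod 3 = 0 then 0 else 1) \<and> ?t c2 = (if ?c mod 3 = 2 then 1 else 0)"
    proof (cases "q = a")
      case False
      then have "?t = \<sigma>" using t a by (simp add: P_def)
      then show ?thesis using False c by simp
    next
      case qa: True
      define u where "u = exec w (chosen_prog m) \<sigma>"
      have u: "u y = \<sigma> y" if "y \<noteq> fl" for y
        unfolding u_def by (rule exec_frame) (use that in simp)
      have ufl: "u fl = 0 \<longleftrightarrow> v \<notin> F" using exec_chosen[OF w, of m \<sigma>] t F by (simp add: u_def)
      have tu: "?t = (if u fl = 0 then exec w count_mod3 u else u)"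
        using qa t a u[of 0] z by (auto simp: P_def u_def)
      show ?thesis
      proof (cases "v \<notin> F")
        case True
        then have "?t = exec w count_mod3 u" "?c = Suc c" using tu ufl qa by auto
        then show ?thesis using exec_count_mod3[of w u c] w z c u by simp
      next
        case False
        then show ?thesis using tu ufl c u by simp
      qed
    qed
    moreover have "exec w (scan_prog m) \<sigma> = exec w (Seq (Inc rv) (Zero cc)) ?t"
      using True t i z by (simp add: scan_prog_def P_def)
    ultimately show ?thesis using True t i fr[of seen] fr[of rv] unfolding x
      by (simp add: tracks_def)
  qed
qed

section \<open>Runs on an encoded instance\<close>

context
  fixes n :: nat and E col w
  defines "w \<equiv> encode n E col"
begin

lemma w_alphabet: "set w \<subseteq> {1, 2, 3}"
  unfolding w_def by (rule set_encode_word)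

lemma n_less: "Suc n \<le> length w"
  by (simp add: w_def encode_length_bounds)

lemma w_nonempty: "w \<noteq> []"
  using n_less by auto

lemma exec_class:
  assumes z: "\<sigma> 0 = 0"
  shows "exec w (class_prog m) \<sigma> bad = 0 \<longleftrightarrow> \<sigma> bad = 0 \<and>
    3 dvd card {v. v < n \<and> col v = \<sigma> ac \<and> v \<notin> (\<lambda>h. \<sigma> (reg h)) ` {..<m}}"
proof -
  define \<tau> where "\<tau> = \<sigma>(c1 := 0, c2 := 0, seen := 0, cc := 0, rv := 0)"
  define p where "p = scan_prog m"
  define S where "S i = fold (\<lambda>i \<sigma>. exec w p (\<sigma>(rp := i))) [0..<i] \<tau>" for i
  have S: "S 0 = \<tau>" "S (Suc i) = exec w p ((S i)(rp := i))" for i by (simp_all add: S_def)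
  define F where "F = (\<lambda>h. \<sigma> (reg h)) ` {..<m}"
  let ?x = "\<lambda>i. fold (scan_step (\<sigma> ac) F) (take i w) (False, 0, 0, 0)"
  have fr: "S i y = \<sigma> y" if "y \<notin> {fl, c1, c2, rv, cc, seen, rp}" for i y
  proof (induction i)
    case 0
    then show ?case using that by (simp add: S \<tau>_def)
  next
    case (Suc i)
    have "exec w p ((S i)(rp := i)) y = ((S i)(rp := i)) y"
      by (rule exec_frame) (use that in \<open>auto simp: p_def\<close>)
    then show ?case using Suc that by (simp add: S)
  qed
  have tr: "tracks (S i) i (?x i)" if "i \<le> length w" for i
    using that
  proof (induction i)
    case 0
    then show ?case by (simp add: S tracks_def \<tau>_def)
  next
    case (Suc i)
    have "tracks (S i) i (?x i)" using Suc by simp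
    then have "tracks ((S i)(rp := i)) i (?x i)" by (simp add: tracks_def)
    then have "tracks (exec w p ((S i)(rp := i))) (Suc i) (scan_step (\<sigma> ac) F (cell w i) (?x i))"
      unfolding p_def using Suc.prems fr[of 0 i] fr[of ac i] z
      by (intro exec_scan) (auto simp: F_def fr)
    then show ?case using Suc.prems
      by (simp add: S take_Suc_conv_app_nth cell_def nth0_def)
  qed
  have "tracks (S (length w)) (length w) (True, 0, n, card {v. v < n \<and> col v = \<sigma> ac \<and> v \<notin> F})"
    using tr[OF order_refl] scan_encode[of "\<sigma> ac" F n E col] by (simp add: w_def)
  then have c: "S (length w) c1 = 0 \<longleftrightarrow> 3 dvd card {v. v < n \<and> col v = \<sigma> ac \<and> v \<notin> F}"
    by (auto simp: tracks_def dvd_eq_mod_eq_0)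
  define \<rho> where "\<rho> = exec w (For rp (Cell 0) p) \<tau>"
  have "\<rho> = (S (length w))(rp := length w)"
    unfolding \<rho>_def S_def by (rule exec_For_all[OF _ w_alphabet]) (simp add: p_def)
  then have \<rho>: "\<rho> 0 = 0" "\<rho> bad = \<sigma> bad" "\<rho> c1 = S (length w) c1" using fr z by simp_all
  have "exec w (class_prog m) \<sigma> = exec w (Cond c1 (At 0) Skip (Inc bad)) \<rho>"
    by (simp add: class_prog_def \<rho>_def \<tau>_def p_def)
  then show ?thesis using \<rho> c w_nonempty unfolding F_def by (cases "\<sigma> bad") auto
qed

lemma exec_classes:
  assumes z: "\<sigma> 0 = 0" and cb: "\<And>v. v < n \<Longrightarrow> col v < length w"
  shows "exec w (For ac (Cell 0) (class_prog m)) \<sigma> bad = 0 \<longleftrightarrow> \<sigma> bad = 0 \<and>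
    (\<forall>a. 3 dvd card {v. v < n \<and> col v = a \<and> v \<notin> (\<lambda>h. \<sigma> (reg h)) ` {..<m}})"
proof -
  define p where "p = class_prog m"
  define S where "S i = fold (\<lambda>i \<sigma>. exec w p (\<sigma>(ac := i))) [0..<i] \<sigma>" for i
  have S: "S 0 = \<sigma>" "S (Suc i) = exec w p ((S i)(ac := i))" for i by (simp_all add: S_def)
  define F where "F = (\<lambda>h. \<sigma> (reg h)) ` {..<m}"
  have fr: "S i y = \<sigma> y" if "y \<notin> {fl, c1, c2, rv, cc, seen, rp, bad, ac}" for i y
  proof (induction i)
    case (Suc i)
    have "exec w p ((S i)(ac := i)) y = ((S i)(ac := i)) y"
      by (rule exec_frame) (use that in \<open>auto simp: p_def\<close>)
    then show ?case using Suc that by (simp add: S)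
  qed (simp add: S)
  have inv: "S i bad = 0 \<longleftrightarrow> \<sigma> bad = 0 \<and> (\<forall>a<i. 3 dvd card {v. v < n \<and> col v = a \<and> v \<notin> F})" for i
  proof (induction i)
    case (Suc i)
    have "S (Suc i) bad = 0 \<longleftrightarrow> S i bad = 0 \<and> 3 dvd card {v. v < n \<and> col v = i \<and> v \<notin> F}"
      using exec_class[of "(S i)(ac := i)" m] fr z by (simp add: S p_def F_def)
    then show ?case using Suc by (auto simp: less_Suc_eq)
  qed (simp add: S)
  \<comment> \<open>All colours are below \<open>length w\<close>, so the classes the loop does not
    reach are empty and satisfy the condition.\<close>
  have "{v. v < n \<and> col v = a \<and> v \<notin> F} = {}" if "\<not> a < length w" for a
    using cb that by auto
  then have "(\<forall>a<length w. 3 dvd card {v. v < n \<and> col v = a \<and> v \<notin> F}) \<longleftrightarrow>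
      (\<forall>a. 3 dvd card {v. v < n \<and> col v = a \<and> v \<notin> F})"
    by (metis card.empty dvd_0_right)
  moreover have "exec w (For ac (Cell 0) p) \<sigma> = (S (length w))(ac := length w)"
    unfolding S_def by (rule exec_For_all[OF _ w_alphabet]) (simp add: p_def)
  ultimately show ?thesis using inv[of "length w"] unfolding p_def F_def by simp
qed

text \<open>\<open>acc\<close> preserves earlier successes, so that the enclosing loops compute an
  existential quantifier.\<close>

lemma exec_check:
  assumes z: "\<sigma> 0 = 0" and nn: "\<sigma> nn = n" and le: "\<And>h. h < m \<Longrightarrow> \<sigma> (reg h) \<le> n"
  shows "exec w (check_prog m) \<sigma> acc \<noteq> 0 \<longleftrightarrow> \<sigma> acc \<noteq> 0 \<or> good_choice n E col m (\<lambda>h. \<sigma> (reg h))"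
proof -
  define \<tau> where "\<tau> = exec w (pairs_prog m) (\<sigma>(bad := 0))"
  have \<tau>: "\<tau> y = \<sigma> y" if "y \<notin> {rp, ri, rj, bad}" for y
    using exec_frame[of y "pairs_prog m" w "\<sigma>(bad := 0)"] mods_pairs[of m] that
    unfolding \<tau>_def by auto
  have "u * n + v < length w \<and> (cell w (u * n + v) = 2 \<longleftrightarrow> E u v)" if "u < n" "v < n" for u v
    using that encode_length_bounds(3)[of u n v E col] encode_nth[of u n v E col]
    by (simp add: w_def cell_def nth0_def bit_sym_def)
  then have 1: "\<tau> bad = 0 \<longleftrightarrow>
    (\<forall>h<m. \<forall>g<m. h \<noteq> g \<longrightarrow> pair_ok n E (h div 3 = g div 3) (\<sigma> (reg h)) (\<sigma> (reg g)))"
    using exec_pairs[of w "\<sigma>(bad := 0)" n m E] w_nonempty nn le n_less unfolding \<tau>_def by simp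
  define \<rho> where "\<rho> = exec w (For ac (Cell 0) (class_prog m)) \<tau>"
  have \<rho>: "\<rho> y = \<tau> y" if "y \<notin> {fl, c1, c2, rv, cc, seen, rp, bad, ac}" for y
    unfolding \<rho>_def by (rule exec_frame) (use that in auto)
  have "\<rho> bad = 0 \<longleftrightarrow> \<tau> bad = 0 \<and>
      (\<forall>a. 3 dvd card {v. v < n \<and> col v = a \<and> v \<notin> (\<lambda>h. \<sigma> (reg h)) ` {..<m}})"
    using exec_classes[of \<tau> m] \<tau> z encode_length_bounds(2)[of _ n col E]
    by (simp add: \<rho>_def w_def)
  with 1 have "\<rho> bad = 0 \<longleftrightarrow> good_choice n E col m (\<lambda>h. \<sigma> (reg h))"
    by (simp add: good_choice_def)
  moreover have "exec w (check_prog m) \<sigma> = exec w (Cond bad (At 0) (Inc acc) Skip) \<rho>"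
    by (simp add: check_prog_def \<tau>_def \<rho>_def)
  moreover have "\<rho> 0 = 0" "\<rho> acc = \<sigma> acc" using \<rho> \<tau> z by simp_all
  ultimately show ?thesis using w_nonempty by (cases "\<sigma> acc") auto
qed

lemma good_choice_cong:
  "(\<And>h. h < m \<Longrightarrow> f h = g h) \<Longrightarrow> good_choice n E col m f \<longleftrightarrow> good_choice n E col m g"
proof -
  assume *: "\<And>h. h < m \<Longrightarrow> f h = g h"
  then have "f ` {..<m} = g ` {..<m}" by (intro image_cong) auto
  with * show ?thesis unfolding good_choice_def by simp
qed

text \<open>Entries from \<open>j\<close> on have been fixed by the enclosing loops, those below
  \<open>j\<close> are still free; \<open>j = m\<close> gives the unrestricted search.\<close>

lemma exec_search:
  assumes "j \<le> m" "\<sigma> 0 = 0" "\<sigma> nn = n" "\<sigma> n1 = Suc n" "\<And>h. h < m \<Longrightarrow> j \<le> h \<Longrightarrow> \<sigma> (reg h) \<le> n"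
  shows "exec w (search_prog m j) \<sigma> acc \<noteq> 0 \<longleftrightarrow> \<sigma> acc \<noteq> 0 \<or>
    (\<exists>f. (\<forall>h. f h \<le> n) \<and> (\<forall>h<m. j \<le> h \<longrightarrow> f h = \<sigma> (reg h)) \<and> good_choice n E col m f)"
  using assms
proof (induction j arbitrary: \<sigma>)
  case 0
  have "(\<exists>f. (\<forall>h. f h \<le> n) \<and> (\<forall>h<m. 0 \<le> h \<longrightarrow> f h = \<sigma> (reg h)) \<and> good_choice n E col m f) \<longleftrightarrow>
      good_choice n E col m (\<lambda>h. \<sigma> (reg h))" (is "?L \<longleftrightarrow> ?R")
  proof
    assume ?L
    then obtain f where "\<And>h. h < m \<Longrightarrow> f h = \<sigma> (reg h)" "good_choice n E col m f" by auto
    then show ?R using good_choice_cong[of m f "\<lambda>h. \<sigma> (reg h)"] by simp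
  next
    assume r: ?R
    \<comment> \<open>Registers beyond entry \<open>m\<close> are not known to be bounded, so the
      value \<open>n\<close> is used there to keep \<open>f h \<le> n\<close>.\<close>
    let ?f = "\<lambda>h. if h < m then \<sigma> (reg h) else n"
    have "good_choice n E col m ?f" using r good_choice_cong[of m ?f "\<lambda>h. \<sigma> (reg h)"] by simp
    then show ?L using 0 by (intro exI[of _ ?f]) auto
  qed
  then show ?case using exec_check[of \<sigma> m] 0 by simp
next
  case (Suc j)
  note IHj = Suc.IH
  define p where "p = search_prog m j"
  define S where "S i = fold (\<lambda>i \<sigma>. exec w p (\<sigma>(reg j := i))) [0..<i] \<sigma>" for i
  have S: "S 0 = \<sigma>" "S (Suc i) = exec w p ((S i)(reg j := i))" for i by (simp_all add: S_def)
  have mp: "y \<notin> mods p" if "y < ri \<or> reg j \<le> y" for y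
    using mods_search[of m j] that by (auto simp: p_def subset_iff)
  have fr: "S i y = \<sigma> y" if "y < ri \<or> reg j < y" for i y
  proof (induction i)
    case (Suc i)
    have "exec w p ((S i)(reg j := i)) y = ((S i)(reg j := i)) y"
      by (rule exec_frame) (use that mp in auto)
    then show ?case using Suc that by (auto simp: S)
  qed (simp add: S)
  \<comment> \<open>\<open>?ex u\<close>: some good choice extends the entries already fixed by the
    value \<open>u\<close> at position \<open>j\<close>.\<close>
  let ?ex = "\<lambda>u. \<exists>f. (\<forall>h. f h \<le> n) \<and> f j = u \<and> (\<forall>h<m. Suc j \<le> h \<longrightarrow> f h = \<sigma> (reg h)) \<and>
    good_choice n E col m f"
  have inv: "S i acc \<noteq> 0 \<longleftrightarrow> \<sigma> acc \<noteq> 0 \<or> (\<exists>u<i. ?ex u)" if "i \<le> Suc n" for i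
    using that
  proof (induction i)
    case (Suc i)
    define \<tau> where "\<tau> = (S i)(reg j := i)"
    have \<tau>: "\<tau> 0 = 0" "\<tau> nn = n" "\<tau> n1 = Suc n" "\<tau> acc = S i acc" "\<tau> (reg j) = i"
      using fr \<open>\<sigma> 0 = 0\<close> \<open>\<sigma> nn = n\<close> \<open>\<sigma> n1 = Suc n\<close> unfolding \<tau>_def by auto
    have \<tau>h: "\<tau> (reg h) = \<sigma> (reg h)" if "j < h" for h
      using fr[of "reg h" i] that unfolding \<tau>_def by auto
    have "\<tau> (reg h) \<le> n" if "h < m" "j \<le> h" for h
      using that \<tau>(5) \<tau>h[of h] Suc.prems \<open>\<And>h. h < m \<Longrightarrow> Suc j \<le> h \<Longrightarrow> \<sigma> (reg h) \<le> n\<close>[of h]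
      by (cases "h = j") auto
    then have "exec w p \<tau> acc \<noteq> 0 \<longleftrightarrow> \<tau> acc \<noteq> 0 \<or>
      (\<exists>f. (\<forall>h. f h \<le> n) \<and> (\<forall>h<m. j \<le> h \<longrightarrow> f h = \<tau> (reg h)) \<and> good_choice n E col m f)"
      unfolding p_def using \<open>Suc j \<le> m\<close> \<tau> by (intro IHj) auto
    moreover have "(\<forall>h<m. j \<le> h \<longrightarrow> f h = \<tau> (reg h)) \<longleftrightarrow>
      f j = i \<and> (\<forall>h<m. Suc j \<le> h \<longrightarrow> f h = \<sigma> (reg h))" for f
      using \<open>Suc j \<le> m\<close> \<tau>(5) \<tau>h by (metis Suc_le_eq le_eq_less_or_eq)
    ultimately have "S (Suc i) acc \<noteq> 0 \<longleftrightarrow> S i acc \<noteq> 0 \<or> ?ex i"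
      using \<tau>(4) by (simp add: S \<tau>_def conj_assoc)
    moreover have "(\<exists>u<Suc i. ?ex u) \<longleftrightarrow> (\<exists>u<i. ?ex u) \<or> ?ex i" by (auto simp: less_Suc_eq)
    moreover have "S i acc \<noteq> 0 \<longleftrightarrow> \<sigma> acc \<noteq> 0 \<or> (\<exists>u<i. ?ex u)"
      by (rule Suc.IH) (use Suc.prems in simp)
    ultimately show ?case by argo
  qed (simp add: S)
  have "exec w (For (reg j) (At n1) p) \<sigma> = (S (Suc n))(reg j := Suc n)"
    using exec_For_upto[of "reg j" p n1 \<sigma> w] mp[of "reg j"] mp[of n1] n_less Suc.prems(4)
    by (simp add: S_def)
  then have "exec w (search_prog m (Suc j)) \<sigma> acc = S (Suc n) acc" by (simp add: p_def)
  \<comment> \<open>Each admissible \<open>f\<close> has \<open>f j \<le> n\<close>, so the values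
    \<open>u < Suc n\<close> cover all of them.\<close>
  moreover have "(\<exists>u<Suc n. ?ex u) \<longleftrightarrow>
    (\<exists>f. (\<forall>h. f h \<le> n) \<and> (\<forall>h<m. Suc j \<le> h \<longrightarrow> f h = \<sigma> (reg h)) \<and> good_choice n E col m f)"
    by (auto simp: less_Suc_eq_le)
  ultimately show ?case using inv[of "Suc n"] by simp
qed

lemma exec_init:
  defines "\<sigma> \<equiv> exec w init_prog (\<lambda>_. 0)"
  shows "\<sigma> nn = n" "\<sigma> n1 = Suc n" "y \<notin> {nn, n1, ri} \<Longrightarrow> \<sigma> y = 0"
proof -
  define p where "p = Cond ri (Cell 3) (Seq (Cond n1 (At 0) Skip (Inc nn)) (Inc n1)) Skip"
  define S where "S i = fold (\<lambda>i \<sigma>. exec w p (\<sigma>(ri := i))) [0..<i] (\<lambda>_. 0)" for i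
  have S: "S 0 = (\<lambda>_. 0)" "S (Suc i) = exec w p ((S i)(ri := i))" for i by (simp_all add: S_def)
  have z: "S i 0 = 0" for i by (induction i) (simp_all add: S p_def)
  \<comment> \<open>Truncated subtraction matches the skipped separator: \<open>nn\<close> stays 0
    until the second one.\<close>
  have c: "S i n1 = count_list (take i w) 3 \<and> S i nn = count_list (take i w) 3 - 1" if "i \<le> length w" for i
    using that
  proof (induction i)
    case (Suc i)
    have "count_list (take i w) 3 \<le> i" using count_le_length[of "take i w" 3] Suc.prems by simp
    then show ?case using Suc z[of i]
      by (auto simp: S p_def take_Suc_conv_app_nth cell_def nth0_def)
  qed (simp add: S)
  have "\<sigma> = (S (length w))(ri := length w)"
    unfolding \<sigma>_def init_prog_def S_def p_def by (rule exec_For_all[OF _ w_alphabet]) simp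
  then show "\<sigma> nn = n" "\<sigma> n1 = Suc n"
    using c[OF order_refl] count_encode[of n E col] by (simp_all add: w_def)
  show "\<sigma> y = 0" if "y \<notin> {nn, n1, ri}"
    unfolding \<sigma>_def using that by (subst exec_frame) (auto simp: init_prog_def)
qed

lemma exec_main:
  "exec w (main_prog m) (\<lambda>_. 0) acc \<noteq> exec w (main_prog m) (\<lambda>_. 0) 0 \<longleftrightarrow>
    (\<exists>f. (\<forall>h. f h \<le> n) \<and> good_choice n E col m f)"
proof -
  have "0 \<notin> mods (main_prog m)"
    using mods_search[of m m] by (auto simp: main_prog_def init_prog_def)
  then have "exec w (main_prog m) (\<lambda>_. 0) 0 = 0" by (simp add: exec_frame)
  moreover have "exec w (main_prog m) (\<lambda>_. 0) acc \<noteq> 0 \<longleftrightarrow>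
    (\<exists>f. (\<forall>h. f h \<le> n) \<and> good_choice n E col m f)"
    using exec_search[of m m "exec w init_prog (\<lambda>_. 0)"] exec_init
    by (simp add: main_prog_def)
  ultimately show ?thesis by simp
qed

end

theorem mainTheorem15:
  fixes k :: nat
  shows "\<exists>M (c::nat) (d::nat). wf_tm M \<and>
    (\<forall>n E col. clique_partition_instance k n E col \<longrightarrow>
       (let cfg = run M (c * (length (encode n E col) + 1) ^ d) (encode n E col)
        in halted M cfg \<and> (accepted M cfg \<longleftrightarrow> triangle_partitionable n E)))"
proof -
  \<comment> \<open>Three entries for each of \<open>2 * k ^ 3\<close> triangles. This number
    determines the program, hence the machine and the exponent \<open>d\<close>.\<close>
  let ?m = "6 * k ^ 3"
  interpret compiled "reg ?m" acc "main_prog ?m"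
    by standard (simp_all add: wf_prog_main)
  obtain M c d where "wf_tm M" and M: "\<And>w. set w \<subseteq> {1, 2, 3} \<Longrightarrow>
     (let cfg = run M (c * (length w + 1) ^ d) w in halted M cfg \<and>
      (accepted M cfg \<longleftrightarrow> exec w (main_prog ?m) (\<lambda>_. 0) acc \<noteq> exec w (main_prog ?m) (\<lambda>_. 0) 0))"
    using polynomial_time_tm_of_program by blast
  have "let cfg = run M (c * (length (encode n E col) + 1) ^ d) (encode n E col)
      in halted M cfg \<and> (accepted M cfg \<longleftrightarrow> triangle_partitionable n E)"
    if "clique_partition_instance k n E col" for n E col
    using M[OF set_encode_word, of n E col] exec_main[of n E col ?m]
      triangle_partitionable_iff_good_choice[OF that]
    by (simp add: Let_def)
  with \<open>wf_tm M\<close> show ?thesis by blast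
qed

end
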